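(* Let $a,b\geq 2$ be multiplicatively independent integers. Let $X\subseteq[0,1]$ be a closed set with $T_aX\subseteq X$ that admits a non-atomic $T_a$-invariant Borel probability measure whose support is all of $X$. Then $X$ contains a dense $G_\delta$ subset (dense and $G_\delta$ relative to $X$) consisting of points $x$ whose orbit $\{T_b^n x\}_{n\geq 0}$ is dense in $[0,1]$.
   Context: For an integer $a\ge 2$, $T_a:[0,1]\to[0,1]$ is the map $T_a x = ax \bmod 1$. Integers $a,b\geq 2$ are multiplicatively independent if $a^m\neq b^n$ for all positive integers $m,n$. *)

theory Defs
  imports "HOL-Probability.Probability"
begin

definition mult_indep :: "nat \<Rightarrow> nat \<Rightarrow> bool" where
  "mult_indep a b \<longleftrightarrow> (\<forall>m n. 0 < m \<longrightarrow> 0 < n \<longrightarrow> a ^ m \<noteq> b ^ n)"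

text \<open>The map is total on the reals, but only its restriction to the interval
  \<open>{0..1}\<close> is of interest; in particular \<open>times_map a 1 = 0\<close>.\<close>

definition times_map :: "nat \<Rightarrow> real \<Rightarrow> real" where
  "times_map a x = frac (of_nat a * x)"

definition borel_prob_unit_interval :: "real measure \<Rightarrow> bool" where
  "borel_prob_unit_interval M \<longleftrightarrow>
     prob_space M \<and> sets M = sets (restrict_space borel {0..1})"

definition invariant_measure :: "('a \<Rightarrow> 'a) \<Rightarrow> 'a measure \<Rightarrow> bool" where
  "invariant_measure T M \<longleftrightarrow>
     T \<in> measurable M M \<and> (\<forall>A\<in>sets M. emeasure M (T -` A \<inter> space M) = emeasure M A)"

definition measure_atom :: "'a measure \<Rightarrow> 'a set \<Rightarrow> bool" where
  "measure_atom M A \<longleftrightarrow>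
     A \<in> sets M \<and> emeasure M A > 0 \<and>
     (\<forall>B\<in>sets M. B \<subseteq> A \<longrightarrow> emeasure M B = 0 \<or> emeasure M (A - B) = 0)"

definition non_atomic :: "'a measure \<Rightarrow> bool" where
  "non_atomic M \<longleftrightarrow> (\<nexists>A. measure_atom M A)"

text \<open>The topological support, taken inside \<open>space M\<close> with its subspace topology: the relatively
  open sets are those of the form \<open>U \<inter> space M\<close> with \<open>U\<close> open.\<close>

definition measure_support :: "'a::topological_space measure \<Rightarrow> 'a set" where
  "measure_support M =
     {x \<in> space M. \<forall>U. open U \<longrightarrow> x \<in> U \<longrightarrow> emeasure M (U \<inter> space M) > 0}"

definition forward_orbit :: "('a \<Rightarrow> 'a) \<Rightarrow> 'a \<Rightarrow> 'a set" where
  "forward_orbit T x = range (\<lambda>n. (T ^^ n) x)"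

end

theory Submission
  imports Defs "HOL-Number_Theory.Number_Theory"
begin

text \<open>
  Given open sets \<open>V\<close> meeting \<open>X\<close> and \<open>U\<close>, suppose that no point of \<open>V \<inter> X\<close> is sent into \<open>U\<close> by a power
  of \<open>b\<close>. Let \<open>W\<close> be the closure of \<open>{(x, b\<^sup>n x)}\<close>, \<open>x\<close> in \<open>X\<close>; it is invariant under \<open>(x, z) \<mapsto> (ax, az)\<close>
  and \<open>(x, z) \<mapsto> (x, bz)\<close>. The engine is a variant of Furstenberg's argument: if \<open>S\<close> is a relation with
  these invariances that accumulates at \<open>(x, 0)\<close> off the zero section, for a set of \<open>x \<in> V\<close> of
  positive measure, then the fibres of \<open>S\<close> over \<open>V\<close> are jointly dense. Indeed some orbit visits
  this set with frequency \<open>\<delta> > 0\<close>, whereas the numbers \<open>a\<^sup>k e\<close> (\<open>e\<close> small), rescaled by powers of \<open>b\<close>,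
  equidistribute logarithmically, and so rarely lie in the null set of points whose orbit
  under multiplication by \<open>b\<close> misses \<open>U\<close>.

  This engine first shows that almost no fibre of \<open>W\<close> over \<open>V\<close> contains a rational. Hence for every
  invariant \<open>Y \<subseteq> W\<close> almost every nonempty fibre is infinite, and the engine applied to the difference
  relation of \<open>Y\<close> gives \<open>z, z + s \<in> Y\<^sub>x\<close> for all \<open>x \<in> V \<inter> X\<close>. After passing to powers with
  \<open>a\<^sup>m \<equiv> b\<^sup>m \<equiv> 1\<close> modulo \<open>q\<close>, the translation by \<open>1/q\<close> preserves the invariances, so the last step iterates
  and places a whole progression \<open>z, z + 1/q, \<dots>\<close> in \<open>W\<^sub>x\<close>, which meets \<open>U\<close>. The theorem follows by Baire.
\<close>

section \<open>Logarithmic equidistribution\<close>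

text \<open>Only the upper half of equidistribution of a rotation is established. The error
  \<open>K\<close> depends on \<open>\<alpha>\<close> and \<open>l\<close> alone, so it is uniform
  in the phase \<open>c\<close> and in the position \<open>v\<close> of the interval.\<close>

lemma count_rotation_hits:
  fixes \<alpha> l :: real
  assumes irr: "\<alpha> \<notin> \<rat>" and l: "0 < l" "l \<le> 1/4"
  shows "\<exists>K. \<forall>(N::nat) c v. card {k. k < N \<and> (\<exists>n::int. real k * \<alpha> + c + n \<in> {v..v+l})} \<le> 4 * l * N + K"
proof -
  \<comment> \<open>The targets \<open>2*i*l\<close> for \<open>i < M\<close> fit into the unit
    interval with spacing \<open>2*l\<close>. Since \<open>l\<close> is at most 1/4, rounding down
    keeps \<open>M\<close> at least \<open>1/(4*l)\<close>, which is where the factor 4 comes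
    from.\<close>
  define M where "M = nat \<lfloor>1 / (2*l)\<rfloor>"
  have fl: "real M = of_int \<lfloor>1 / (2*l)\<rfloor>" using l unfolding M_def by simp
  have M1: "real M \<le> 1/(2*l)" using fl by linarith
  have "1 \<le> 1/(4*l)" using l by (simp add: field_simps)
  moreover have "real M > 1/(2*l) - 1" using fl by linarith
  moreover have "1/(2*l) = 2 * (1/(4*l))" by simp
  ultimately have M2: "real M \<ge> 1/(4*l)" by linarith
  have M1': "2 * l * M \<le> 1" using M1 l by (simp add: field_simps)
  have M2': "4 * l * M \<ge> 1" using M2 l by (simp add: field_simps)
  have "\<exists>m::nat. \<bar>frac (real m * \<alpha>) - 2*real i*l\<bar> < l/2" if "i < M" for i :: nat
  proof -
    have "2 * real i * l \<le> 2 * l * M" using that l by simp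
    then have "2 * real i * l \<le> 1" using M1' by linarith
    moreover have "0 \<le> 2 * real i * l" using l by simp
    ultimately show ?thesis
      using Kronecker_approx_1_explicit[OF irr, of "2*real i*l" "l/2"] l by (metis half_gt_zero)
  qed
  txt \<open>The multiples \<open>m i * \<alpha>\<close> are pairwise more than \<open>l\<close> apart modulo 1, so the shifts by \<open>m i\<close> of the
    hitting times of an interval of length \<open>l\<close> are disjoint.\<close>
  then obtain m :: "nat \<Rightarrow> nat" where m: "\<And>i. i < M \<Longrightarrow> \<bar>frac (real (m i) * \<alpha>) - 2*real i*l\<bar> < l/2"
    by metis
  have sep: False if ij: "i < M" "j < i" and r: "\<bar>(real (m i) - real (m j)) * \<alpha> - of_int n\<bar> \<le> l" for i j and n :: int
  proof -
    let ?d = "frac (real (m i) * \<alpha>) - frac (real (m j) * \<alpha>)"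
    have mi: "\<bar>frac (real (m i) * \<alpha>) - 2*real i*l\<bar> < l/2" "\<bar>frac (real (m j) * \<alpha>) - 2*real j*l\<bar> < l/2"
      using m ij by auto
    have "(real j + 1) * (2*l) \<le> i * (2*l)" using ij l by (intro mult_right_mono) auto
    then have "2 * real j * l + 2 * l \<le> 2 * real i * l" by (simp add: algebra_simps)
    then have d1: "?d > l" using mi by linarith
    have "(real i + 1) * (2*l) \<le> M * (2*l)" using ij l by (intro mult_right_mono) auto
    then have "2 * real i * l + 2 * l \<le> 2 * l * M" by (simp add: algebra_simps)
    moreover have "2 * real j * l \<ge> 0" using l by simp
    ultimately have d2: "?d < 1 - l" using mi M1' by linarith
    define n' where "n' = n - \<lfloor>real (m i) * \<alpha>\<rfloor> + \<lfloor>real (m j) * \<alpha>\<rfloor>"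
    have "\<bar>?d - of_int n'\<bar> \<le> l" using r by (simp add: frac_def n'_def algebra_simps)
    then have "of_int n' > (0::real)" "of_int n' < (1::real)" using d1 d2 by linarith+
    then show False by simp
  qed
  define L where "L = (\<Sum>i<M. m i)"
  have mL: "m i \<le> L" if "i < M" for i unfolding L_def using that by (intro member_le_sum) auto
  have "card {k. k < N \<and> (\<exists>n::int. real k * \<alpha> + c + n \<in> {v..v+l})} \<le> 4 * l * N + 4*l*L" for N :: nat and c v :: real
  proof -
    define R where "R = {k. k < N \<and> (\<exists>n::int. real k * \<alpha> + c + n \<in> {v..v+l})}"
    have finR: "finite R" unfolding R_def by simp
    have key: "i = j" if ij: "i < M" "j < M" and k: "k \<in> R" "k' \<in> R" and eq: "k + m i = k' + m j" for i j k k'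
    proof -
      obtain n n' :: int where n: "real k * \<alpha> + c + n \<in> {v..v+l}" "real k' * \<alpha> + c + n' \<in> {v..v+l}"
        using k unfolding R_def by blast
      have e: "real (m i) - real (m j) = real k' - real k" using eq by linarith
      have r: "\<bar>(real (m i) - real (m j)) * \<alpha> - of_int (n-n')\<bar> \<le> l"
        unfolding e using n by (simp add: algebra_simps abs_le_iff)
      have r': "\<bar>(real (m j) - real (m i)) * \<alpha> - of_int (n'-n)\<bar> \<le> l"
        using r by (simp add: algebra_simps abs_le_iff)
      show "i = j" using sep[OF ij(1) _ r] sep[OF ij(2) _ r'] by (meson linorder_neqE_nat)
    qed
    have inj: "inj_on (\<lambda>(i,k). k + m i) ({..<M} \<times> R)"
    proof (rule inj_onI)
      fix p q
      assume *: "p \<in> {..<M} \<times> R" "q \<in> {..<M} \<times> R"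
        "(case p of (i,k) \<Rightarrow> k + m i) = (case q of (i,k) \<Rightarrow> k + m i)"
      obtain i k j k' where pq: "p = (i,k)" "q = (j,k')" by (metis surj_pair)
      then have "i = j" using key[of i j k k'] * by auto
      then show "p = q" using * pq by auto
    qed
    have "(\<lambda>(i,k). k + m i) ` ({..<M} \<times> R) \<subseteq> {..<N+L}"
      using mL by (force simp: R_def intro: add_less_le_mono)
    then have "card ({..<M} \<times> R) \<le> card {..<N+L}" by (intro card_inj_on_le[OF inj]) auto
    then have "M * card R \<le> N + L" by (simp add: card_cartesian_product)
    then have a1: "real M * card R \<le> real N + L" by (metis of_nat_add of_nat_le_iff of_nat_mult)
    have "real (card R) \<le> (4 * l * M) * card R" using M2' by (simp add: mult_le_cancel_right1)
    also have "\<dots> = 4*l*(M * card R)" by simp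
    also have "\<dots> \<le> 4*l*(real N + L)" using a1 l by (intro mult_left_mono) auto
    finally show ?thesis by (simp add: R_def algebra_simps)
  qed
  then show ?thesis by blast
qed

text \<open>This is the lift to the line of the set of points of the circle whose orbit under
  multiplication by \<open>b\<close> enters \<open>U\<close>. The integer \<open>n\<close> replaces
  reduction modulo 1, so only continuous maps occur.\<close>

definition hits :: "nat \<Rightarrow> real set \<Rightarrow> real set" where
  "hits b U = {t. \<exists>(j::nat) (n::int). real b ^ j * t + n \<in> U}"

text \<open>The interval from 1 to \<open>b\<close> is a fundamental domain for multiplication by
  \<open>b\<close> on the positive reals. Of its cells of length \<open>1/B^J\<close>, only a
  fraction of order \<open>((B-1)/B)^J\<close> meets the complement of \<open>hits b U\<close>: a
  quantitative form of being a null set.\<close>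

lemma missing_cover:
  fixes b :: nat
  assumes b: "b \<ge> 2" and U: "open U" "U \<noteq> {}"
  shows "\<exists>B::nat\<ge>2. \<forall>J. finite ((\<lambda>t. \<lfloor>t * real B^J\<rfloor>) ` ({1..<real b} - hits b U)) \<and>
    card ((\<lambda>t. \<lfloor>t * real B^J\<rfloor>) ` ({1..<real b} - hits b U)) \<le> b * (B - 1)^J"
proof -
  obtain u where u: "u \<in> U" using U by blast
  then obtain \<eta> where \<eta>: "\<eta> > 0" "ball u \<eta> \<subseteq> U" using U openE by blast
  obtain L' where L': "(1 / real b)^L' < \<eta>"
    using real_arch_pow_inv[OF \<eta>(1), of "1 / real b"] b by auto
  \<comment> \<open>The successor forces a positive exponent, hence \<open>B\<close> is at least
    \<open>b\<close> and so at least 2.\<close>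
  define L where "L = Suc L'"
  have L: "(1 / real b)^L < \<eta>"
  proof -
    have "(1 / real b)^L \<le> (1 / real b)^L'" unfolding L_def using b by (intro power_decreasing) auto
    then show ?thesis using L' by linarith
  qed
  define B where "B = b ^ L"
  have "b \<le> B" unfolding B_def L_def using b by simp
  then have B2: "B \<ge> 2" using b by simp
  have B\<eta>: "1 / real B < \<eta>" using L by (simp add: B_def power_one_over)
  txt \<open>\<open>U\<close> contains, modulo 1, the numbers whose first digit in base \<open>B\<close> is \<open>c\<close>, so the expansion of a
    number outside \<open>hits b U\<close> omits this digit after the radix point.\<close>
  define c where "c = \<lfloor>u * B\<rfloor> mod int B"
  have good: "t \<in> hits b U" if "\<lfloor>t * real B ^ Suc i\<rfloor> mod int B = c" for t :: real and i
  proof -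
    define s where "s = t * real B ^ i"
    have ts: "t * real B ^ Suc i = s * B" by (simp add: s_def)
    have "\<lfloor>s * B\<rfloor> mod int B = \<lfloor>u * B\<rfloor> mod int B" using that unfolding c_def ts by simp
    then have "int B dvd \<lfloor>u * B\<rfloor> - \<lfloor>s * B\<rfloor>" by (metis mod_eq_dvd_iff)
    then obtain n where "\<lfloor>u * B\<rfloor> - \<lfloor>s * B\<rfloor> = int B * n" by (auto elim: dvdE)
    then have "of_int \<lfloor>u * B\<rfloor> - of_int \<lfloor>s * B\<rfloor> = real B * of_int n"
      by (metis of_int_diff of_int_mult of_int_of_nat_eq)
    then have "\<bar>u * B - s * B - real B * of_int n\<bar> < 1" by linarith
    then have "\<bar>real B * (u - (s + of_int n))\<bar> < 1" by (simp add: algebra_simps)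
    then have "real B * \<bar>u - (s + of_int n)\<bar> < 1" by (simp add: abs_mult)
    then have "\<bar>u - (s + of_int n)\<bar> < 1 / B" using B2 by (simp add: field_simps)
    then have "s + of_int n \<in> ball u \<eta>" using B\<eta> by (simp add: dist_real_def)
    then have "real b ^ (L * i) * t + of_int n \<in> U" using \<eta>
      by (auto simp: s_def B_def power_mult mult.commute)
    then show ?thesis unfolding hits_def by blast
  qed
  define D where "D J = (\<lambda>t. \<lfloor>t * real B^J\<rfloor>) ` ({1..<real b} - hits b U)" for J
  have c: "c \<in> {0..<int B}" unfolding c_def using B2 by simp
  \<comment> \<open>The index of a cell at level \<open>Suc J\<close> is \<open>B\<close> times the
    index of its parent plus the next digit, and \<open>B - 1\<close> digits remain
    available.\<close>
  have sub: "D (Suc J) \<subseteq> (\<lambda>(d,r). int B * d + r) ` (D J \<times> ({0..<int B} - {c}))" for J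
  proof
    fix y assume "y \<in> D (Suc J)"
    then obtain t where t: "t \<in> {1..<real b} - hits b U" "y = \<lfloor>t * real B^Suc J\<rfloor>" unfolding D_def by blast
    have "y mod int B \<noteq> c" using t good by blast
    moreover have "y div int B = \<lfloor>t * real B^J\<rfloor>"
    proof -
      have "t * real B^J = (t * real B^Suc J) / B" using B2 by simp
      then show ?thesis using t(2) floor_divide_real_eq_div[of "int B" "t * real B^Suc J"] by simp
    qed
    moreover have "y = int B * (y div int B) + y mod int B" by simp
    moreover have "y mod int B \<in> {0..<int B}" using B2 by simp
    ultimately show "y \<in> (\<lambda>(d,r). int B * d + r) ` (D J \<times> ({0..<int B} - {c}))"
      using t(1) unfolding D_def by (intro image_eqI[where x="(y div int B, y mod int B)"]) auto
  qed
  have D0: "D 0 \<subseteq> {1..<int b}"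
    unfolding D_def by (auto simp: le_floor_iff floor_less_iff)
  have "finite (D J) \<and> card (D J) \<le> b * (B - 1)^J" for J
  proof (induction J)
    case 0
    have "card (D 0) \<le> card {1..<int b}" using D0 by (intro card_mono) auto
    then show ?case using finite_subset[OF D0] by simp
  next
    case (Suc J)
    have fin: "finite (D J \<times> ({0..<int B} - {c}))" using Suc by auto
    have "card (D (Suc J)) \<le> card ((\<lambda>(d,r). int B * d + r) ` (D J \<times> ({0..<int B} - {c})))"
      by (rule card_mono[OF finite_imageI[OF fin] sub])
    also have "\<dots> \<le> card (D J \<times> ({0..<int B} - {c}))" by (rule card_image_le[OF fin])
    also have "\<dots> = card (D J) * (B - 1)" using c by (simp add: card_cartesian_product)
    also have "\<dots> \<le> b * (B - 1)^J * (B - 1)" using Suc by simp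
    finally show ?case using finite_subset[OF sub finite_imageI[OF fin]] by (simp add: mult_ac)
  qed
  then show ?thesis using B2 unfolding D_def by blast
qed

lemma mult_indep_log_irrational:
  fixes a b :: nat
  assumes "a \<ge> 2" "b \<ge> 2" "mult_indep a b"
  shows "log b a \<notin> \<rat>"
proof
  assume "log b a \<in> \<rat>"
  then obtain p q :: int where pq: "q > 0" "log b a = p / q" by (metis Rats_cases')
  have pos: "log b a > 0" using assms by simp
  then have "p > 0" using pq by (simp add: zero_less_divide_iff)
  have "real a ^ nat q = real b ^ nat p"
  proof -
    have "real b powr (log b a * real (nat q)) = real a powr real (nat q)"
      using assms by (subst powr_powr[symmetric]) simp
    moreover have "log b a * real (nat q) = real (nat p)" using pq \<open>p > 0\<close> by simp
    ultimately have "real b powr real (nat p) = real a powr real (nat q)" by simp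
    then show ?thesis using assms by (simp add: powr_realpow)
  qed
  then have "a ^ nat q = b ^ nat p" by (metis of_nat_eq_iff of_nat_power)
  then show False using assms(3) pq \<open>p > 0\<close> unfolding mult_indep_def by auto
qed

lemma hits_power: "real b ^ i * t \<in> hits b U \<Longrightarrow> t \<in> hits b U"
  unfolding hits_def by (auto simp: mult.assoc[symmetric] power_add[symmetric])

lemma ex_power_between:
  fixes t b :: real
  assumes "0 < t" "t < b" "b > 1"
  shows "\<exists>i::nat. 1 \<le> b ^ i * t \<and> b ^ i * t < b"
proof -
  define i where "i = (LEAST i. 1 \<le> b ^ i * t)"
  obtain n where "1 / t < b ^ n" using real_arch_pow[OF assms(3)] by blast
  then have ex: "1 \<le> b ^ n * t" using assms by (simp add: field_simps)
  have i: "1 \<le> b ^ i * t" unfolding i_def by (rule LeastI[where P = "\<lambda>i. 1 \<le> b ^ i * t", OF ex])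
  have "b ^ i * t < b"
  proof (cases i)
    case 0 then show ?thesis using assms by simp
  next
    case (Suc j)
    have "\<not> 1 \<le> b ^ j * t" using not_less_Least[of j "\<lambda>i. 1 \<le> b ^ i * t"] Suc by (simp add: i_def)
    then show ?thesis using Suc assms by simp
  qed
  with i show ?thesis by blast
qed

text \<open>Rescaling \<open>a^k * e\<close> by a power of \<open>b\<close> into the fundamental
  domain and taking \<open>log b\<close> gives, modulo 1, the rotation by \<open>log b a\<close>
  started at \<open>log b e\<close>. Each cell covering the missing set becomes a short interval,
  whose visits \<open>count_rotation_hits\<close> bounds. The condition
  \<open>a^N * e \<le> 1\<close> makes nonnegative powers of \<open>b\<close> suffice for the
  rescaling. It is essential later that \<open>N0\<close> does not depend on
  \<open>e\<close>.\<close>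

lemma count_missing:
  fixes a b :: nat and \<delta> :: real
  assumes a: "a \<ge> 2" and b: "b \<ge> 2" and ind: "mult_indep a b" and U: "open U" "U \<noteq> {}"
    and \<delta>: "\<delta> > 0"
  shows "\<exists>N0::nat. \<forall>N\<ge>N0. \<forall>e>0. real a ^ N * e \<le> 1 \<longrightarrow> card {k. k < N \<and> real a ^ k * e \<notin> hits b U} < \<delta> * N"
proof -
  obtain B :: nat where B: "B \<ge> 2"
    "\<forall>J. finite ((\<lambda>t. \<lfloor>t * real B^J\<rfloor>) ` ({1..<real b} - hits b U)) \<and>
      card ((\<lambda>t. \<lfloor>t * real B^J\<rfloor>) ` ({1..<real b} - hits b U)) \<le> b * (B - 1)^J"
    using missing_cover[OF b U] by blast
  let ?r = "(real B - 1) / B"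
  have "(\<lambda>J. 8 * real b * ?r^J) \<longlonglongrightarrow> 8 * real b * 0"
    using B by (intro tendsto_intros LIMSEQ_power_zero) (auto simp: field_simps)
  then have "\<forall>\<^sub>F J in sequentially. 8 * real b * ?r^J < \<delta>/2"
    using \<delta> by (intro order_tendstoD(2)) auto
  \<comment> \<open>The bound \<open>J \<ge> 3\<close> gives \<open>B^J \<ge> 8\<close>, hence
    \<open>l \<le> 1/4\<close> below.\<close>
  then have "\<forall>\<^sub>F J in sequentially. 8 * real b * ?r^J < \<delta>/2 \<and> J \<ge> 3"
    by (rule eventually_conj[OF _ eventually_ge_at_top])
  then obtain J where J: "8 * real b * ?r^J < \<delta>/2" "J \<ge> 3"
    unfolding eventually_sequentially by blast
  \<comment> \<open>A cell with index \<open>d \<ge> B^J\<close> has logarithmic length at most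
    \<open>1/d\<close>, hence at most \<open>1/B^J\<close>, to base e. Passing to base
    \<open>b\<close> costs at most a factor 2, because \<open>ln b \<ge> 1/2\<close>.\<close>
  define l where "l = 2 / real B ^ J"
  have "real 2 ^ 3 \<le> real B ^ 3" using B by (intro power_mono) auto
  also have "\<dots> \<le> real B ^ J" using B J by (intro power_increasing) auto
  finally have B8: "real B ^ J \<ge> 8" by simp
  then have l: "0 < l" "l \<le> 1/4" using B(1) unfolding l_def by (auto simp: divide_le_eq)
  let ?\<alpha> = "log b a"
  obtain K where K: "\<forall>(N::nat) c v. card {k. k < N \<and> (\<exists>n::int. real k * ?\<alpha> + c + n \<in> {v..v+l})} \<le> 4 * l * N + K"
    using count_rotation_hits[OF mult_indep_log_irrational[OF a b ind] l] ..
  define D where "D = (\<lambda>t. \<lfloor>t * real B^J\<rfloor>) ` ({1..<real b} - hits b U)"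
  have D: "finite D" "card D \<le> b * (B - 1)^J" using B unfolding D_def by auto
  define c' where "c' = real (b * (B - 1)^J)"
  \<comment> \<open>This choice makes the accumulated additive errors
    \<open>c' * \<bar>K\<bar>\<close> smaller than half of \<open>\<delta> * N\<close>; the main
    terms take the other half.\<close>
  obtain N0 :: nat where N0: "2 * c' * \<bar>K\<bar> / \<delta> < N0" using reals_Archimedean2 by blast
  have "card {k. k < N \<and> real a ^ k * e \<notin> hits b U} < \<delta> * N"
    if N: "N \<ge> Suc N0" and e: "e > 0" "real a ^ N * e \<le> 1" for N :: nat and e :: real
  proof -
    define H where "H d = {k. k < N \<and> (\<exists>n::int. real k * ?\<alpha> + log b e + n \<in> {log b (d / real B^J)..log b (d / real B^J)+l})}" for d :: int
    have sub: "{k. k < N \<and> real a ^ k * e \<notin> hits b U} \<subseteq> (\<Union>d\<in>D. H d)"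
    proof clarify
      fix k assume k: "k < N" "real a ^ k * e \<notin> hits b U"
      have "real a ^ k * e \<le> real a ^ N * e" using a e k by (intro mult_right_mono power_increasing) auto
      then have "real a ^ k * e < b" using e b by linarith
      moreover have "0 < real a ^ k * e" using a e by simp
      ultimately obtain i where i: "1 \<le> real b ^ i * (real a ^ k * e)" "real b ^ i * (real a ^ k * e) < b"
        using ex_power_between[of "real a ^ k * e" "real b"] b by auto
      define t where "t = real b ^ i * (real a ^ k * e)"
      define d where "d = \<lfloor>t * real B^J\<rfloor>"
      have "t \<notin> hits b U" using k hits_power unfolding t_def by blast
      then have dD: "d \<in> D" unfolding D_def d_def using i t_def by auto
      have BJ: "real B ^ J > 0" using B8 by linarith
      have t1: "t \<ge> 1" using i t_def by simp
      have d1: "of_int d \<ge> real B ^ J"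
      proof -
        have "real B ^ J \<le> t * real B^J" using t1 BJ by simp
        then have "int (B ^ J) \<le> d" unfolding d_def by (simp add: le_floor_iff)
        then show ?thesis by (metis of_int_le_iff of_int_of_nat_eq of_nat_power)
      qed
      have dt: "of_int d / real B^J \<le> t" "t < (of_int d + 1) / real B^J"
        using BJ floor_correct[of "t * real B^J"] unfolding d_def
        by (simp_all add: pos_divide_le_eq pos_less_divide_eq)
      have dpos: "0 < of_int d / real B^J" using d1 BJ by (intro divide_pos_pos) linarith+
      have b1: "real b > 1" using b by simp
      have "log b t = real k * ?\<alpha> + log b e + int i"
        unfolding t_def using a b e by (simp add: log_mult log_nat_power)
      moreover have "log b (d / real B^J) \<le> log b t" using dt dpos b1 by simp
      moreover have "log b t \<le> log b (d / real B^J) + l"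
      proof -
        have lnb: "ln (real b) \<ge> 1/2"
        proof -
          have "ln (2::real) \<le> ln (real b)" using b by simp
          then show ?thesis using ln2_ge_two_thirds by linarith
        qed
        have "t \<noteq> 0 \<and> d / real B^J \<noteq> 0" using dpos t1 by linarith
        then have "ln t - ln (d / real B^J) = ln (t / (d / real B^J))" by (metis ln_div)
        also have "\<dots> \<le> t / (d / real B^J) - 1"
        proof (rule ln_le_minus_one, rule divide_pos_pos)
          show "0 < t" using t1 by linarith
        qed (rule dpos)
        also have "\<dots> \<le> 1 / d"
        proof -
          have "t * real B^J \<le> d + 1" unfolding d_def by linarith
          moreover have "real_of_int d > 0" using d1 BJ by linarith
          ultimately have "(t * real B^J) / d \<le> (d + 1) / d" by (intro divide_right_mono) auto
          also have "\<dots> = 1 + 1 / d" using \<open>real_of_int d > 0\<close> by (simp add: add_divide_distrib)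
          finally show ?thesis by simp
        qed
        also have "\<dots> \<le> 1 / real B^J"
          using d1 BJ by (intro divide_left_mono mult_pos_pos) linarith+
        also have "\<dots> = (1/2) * l" by (simp add: l_def)
        also have "\<dots> \<le> ln b * l" using lnb l by (intro mult_right_mono) auto
        finally have "ln t \<le> ln (d / real B^J) + l * ln b" by (simp add: mult.commute)
        then have "ln t / ln b \<le> (ln (d / real B^J) + l * ln b) / ln b" using lnb by (intro divide_right_mono) auto
        then show ?thesis using lnb by (simp add: log_def add_divide_distrib)
      qed
      ultimately have "k \<in> H d" unfolding H_def using k(1)
        by (auto intro!: exI[of _ "int i"])
      then show "k \<in> (\<Union>d\<in>D. H d)" using dD by blast
    qed
    have finH: "finite (H d)" for d unfolding H_def by simp
    have "card {k. k < N \<and> real a ^ k * e \<notin> hits b U} \<le> card (\<Union>d\<in>D. H d)"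
      using sub D finH by (intro card_mono) auto
    also have "\<dots> \<le> (\<Sum>d\<in>D. card (H d))" by (rule card_UN_le[OF D(1)])
    finally have "real (card {k. k < N \<and> real a ^ k * e \<notin> hits b U}) \<le> real (\<Sum>d\<in>D. card (H d))"
      by (rule of_nat_mono)
    also have "\<dots> = (\<Sum>d\<in>D. real (card (H d)))" by (rule of_nat_sum)
    also have "\<dots> \<le> (\<Sum>d\<in>D. 4 * l * N + \<bar>K\<bar>)"
    proof (rule sum_mono)
      fix d show "real (card (H d)) \<le> 4 * l * N + \<bar>K\<bar>" unfolding H_def using K[rule_format, of N "log b e" "log b (d / real B^J)"] by linarith
    qed
    also have "\<dots> = card D * (4 * l * N + \<bar>K\<bar>)" by simp
    also have "\<dots> \<le> c' * (4 * l * N + \<bar>K\<bar>)"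
    proof (rule mult_right_mono)
      show "card D \<le> c'" unfolding c'_def using D(2) by (rule of_nat_mono)
    qed (use l in simp)
    also have "\<dots> = c' * 4 * l * N + c' * \<bar>K\<bar>" by (simp add: algebra_simps)
    finally have 0: "real (card {k. k < N \<and> real a ^ k * e \<notin> hits b U}) \<le> c' * 4 * l * N + c' * \<bar>K\<bar>" .
    have "c' * 4 * l = 8 * real b * ?r^J"
      using B(1) by (simp add: c'_def l_def power_divide of_nat_diff)
    then have "c' * 4 * l * N \<le> \<delta>/2 * N" using J(1) by (intro mult_right_mono) linarith+
    with 0 have 1: "real (card {k. k < N \<and> real a ^ k * e \<notin> hits b U}) \<le> \<delta>/2 * N + c' * \<bar>K\<bar>" by linarith
    have "2 * c' * \<bar>K\<bar> < \<delta> * N0" using N0 \<delta> by (simp add: field_simps)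
    also have "\<delta> * N0 \<le> \<delta> * N" using N \<delta> by simp
    finally show ?thesis using 1 by linarith
  qed
  then show ?thesis by blast
qed

section \<open>Relations invariant under the skew action\<close>

text \<open>These are lifts to the plane of subsets of the 2-torus. Multiplication by
  \<open>b\<close> acts on the fibre alone, because the base set is only assumed invariant under
  \<open>a\<close>.\<close>

definition skew_invariant :: "nat \<Rightarrow> nat \<Rightarrow> (real \<times> real) set \<Rightarrow> bool" where
  "skew_invariant a b S \<longleftrightarrow>
     (\<forall>x t. (x, t) \<in> S \<longrightarrow> (a * x, a * t) \<in> S \<and> (x, b * t) \<in> S \<and>
       (\<forall>m n. (x + of_int m, t + of_int n) \<in> S))"

lemma skew_invariantD:
  assumes "skew_invariant a b S" "(x, t) \<in> S"
  shows "(real a ^ k * x, real a ^ k * t) \<in> S" "(x, real b ^ j * t) \<in> S"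
    "(x + of_int m, t + of_int n) \<in> S"
proof -
  show "(real a ^ k * x, real a ^ k * t) \<in> S"
  proof (induction k)
    case (Suc k)
    then show ?case using assms(1) by (simp add: skew_invariant_def mult.assoc)
  qed (use assms in simp)
  show "(x, real b ^ j * t) \<in> S"
  proof (induction j)
    case (Suc j)
    then show ?case using assms(1) by (simp add: skew_invariant_def mult.assoc)
  qed (use assms in simp)
  show "(x + of_int m, t + of_int n) \<in> S"
    using assms by (auto simp: skew_invariant_def)
qed

text \<open>The base point may vary along the approach to \<open>(x, 0)\<close>; this is what makes
  the set closed, hence Borel.\<close>

definition vertical_acc :: "(real \<times> real) set \<Rightarrow> real set" where
  "vertical_acc S = {x. (x, 0) \<in> closure (S \<inter> {(y, e). e \<noteq> 0})}"

lemma closed_vertical_acc: "closed (vertical_acc S)"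
proof -
  have "vertical_acc S = (\<lambda>x. (x, 0)) -` closure (S \<inter> {(y, e). e \<noteq> 0})"
    unfolding vertical_acc_def by auto
  then show ?thesis by (simp add: closed_vimage continuous_on_Pair)
qed

lemma vertical_acc_iff:
  "x \<in> vertical_acc S \<longleftrightarrow>
    (\<forall>Q. open Q \<longrightarrow> x \<in> Q \<longrightarrow> (\<forall>\<eta>>0. \<exists>y\<in>Q. \<exists>e. (y, e) \<in> S \<and> e \<noteq> 0 \<and> \<bar>e\<bar> < \<eta>))"
proof
  assume x: "x \<in> vertical_acc S"
  show "\<forall>Q. open Q \<longrightarrow> x \<in> Q \<longrightarrow> (\<forall>\<eta>>0. \<exists>y\<in>Q. \<exists>e. (y, e) \<in> S \<and> e \<noteq> 0 \<and> \<bar>e\<bar> < \<eta>)"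
  proof (intro allI impI)
    fix Q and \<eta> :: real assume Q: "open Q" "x \<in> Q" "\<eta> > 0"
    have "open (Q \<times> ball 0 \<eta>)" using Q by (intro open_Times) auto
    moreover have "(x, 0) \<in> Q \<times> ball 0 \<eta>" using Q by auto
    ultimately have "(Q \<times> ball 0 \<eta>) \<inter> (S \<inter> {(y, e). e \<noteq> 0}) \<noteq> {}"
      using x open_Int_closure_eq_empty unfolding vertical_acc_def by blast
    then show "\<exists>y\<in>Q. \<exists>e. (y, e) \<in> S \<and> e \<noteq> 0 \<and> \<bar>e\<bar> < \<eta>" by force
  qed
next
  assume x: "\<forall>Q. open Q \<longrightarrow> x \<in> Q \<longrightarrow> (\<forall>\<eta>>0. \<exists>y\<in>Q. \<exists>e. (y, e) \<in> S \<and> e \<noteq> 0 \<and> \<bar>e\<bar> < \<eta>)"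
  have "\<exists>p\<in>S \<inter> {(y, e). e \<noteq> 0}. dist p (x, 0) < r" if "r > 0" for r
  proof -
    have "open (ball x (r/2))" "x \<in> ball x (r/2)" "r/2 > 0" using that by auto
    then obtain y e where ye: "y \<in> ball x (r/2)" "(y, e) \<in> S" "e \<noteq> 0" "\<bar>e\<bar> < r/2" using x by meson
    have "dist (y, e) (x, 0) \<le> \<bar>dist y x\<bar> + \<bar>dist e 0\<bar>"
      using sqrt_sum_squares_le_sum_abs[of "dist y x" e] by (simp add: dist_prod_def)
    also have "\<dots> < r" using ye by (simp add: dist_commute)
    finally show ?thesis using ye by (intro bexI[of _ "(y,e)"]) auto
  qed
  then show "x \<in> vertical_acc S" unfolding vertical_acc_def by (simp add: closure_approachable)
qed

lemma vertical_acc_shift: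
  assumes "skew_invariant a b S" "x \<in> vertical_acc S"
  shows "x + of_int m \<in> vertical_acc S"
  unfolding vertical_acc_iff
proof (intro allI impI)
  fix Q and \<eta> :: real assume Q: "open Q" "x + of_int m \<in> Q" "\<eta> > 0"
  have "open ((\<lambda>y. y + of_int m) -` Q)" using Q by (intro open_vimage) (auto intro: continuous_intros)
  then obtain y e where "y + of_int m \<in> Q" "(y, e) \<in> S" "e \<noteq> 0" "\<bar>e\<bar> < \<eta>"
    using assms(2) Q unfolding vertical_acc_iff by (metis vimage_eq)
  then show "\<exists>y\<in>Q. \<exists>e. (y, e) \<in> S \<and> e \<noteq> 0 \<and> \<bar>e\<bar> < \<eta>"
    using skew_invariantD(3)[OF assms(1), of y e m 0] by auto
qed

section \<open>Iterates of the circle map and visits of its orbits\<close>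

lemma times_map_funpow: "((times_map a) ^^ k) x - real a ^ k * x \<in> \<int>"
proof (induction k)
  case (Suc k)
  let ?y = "((times_map a) ^^ k) x"
  obtain n where n: "?y = real a ^ k * x + of_int n" using Suc by (auto elim!: Ints_cases simp: algebra_simps)
  have "((times_map a) ^^ Suc k) x - real a ^ Suc k * x = a * n - \<lfloor>a * ?y\<rfloor>"
    by (simp add: times_map_def frac_def n algebra_simps)
  then show ?case by (metis Ints_diff Ints_mult Ints_of_int Ints_of_nat)
qed simp

lemma invariant_measure_funpow:
  assumes "invariant_measure T M" "A \<in> sets M"
  shows "(T ^^ k) -` A \<inter> space M \<in> sets M \<and> emeasure M ((T ^^ k) -` A \<inter> space M) = emeasure M A"
proof (induction k)
  case 0 then show ?case using assms by (simp add: sets.Int_space_eq2)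
next
  case (Suc k)
  have m: "T \<in> measurable M M" using assms unfolding invariant_measure_def by auto
  let ?A = "(T ^^ k) -` A \<inter> space M"
  have eq: "(T ^^ Suc k) -` A \<inter> space M = T -` ?A \<inter> space M"
    using measurable_space[OF m] by (auto simp: funpow_Suc_right simp del: funpow.simps)
  have "emeasure M (T -` ?A \<inter> space M) = emeasure M ?A"
    using assms(1) Suc unfolding invariant_measure_def by blast
  then show ?case unfolding eq using Suc measurable_sets[OF m, of ?A] by metis
qed

lemma borel_prob_unit_intervalD:
  assumes "borel_prob_unit_interval M"
  shows "prob_space M" "space M = {0..1}" "B \<in> sets borel \<Longrightarrow> B \<inter> {0..1} \<in> sets M"
proof -
  have M: "prob_space M" "sets M = sets (restrict_space borel {0..1})"
    using assms unfolding borel_prob_unit_interval_def by auto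
  show "prob_space M" by (rule M)
  show "space M = {0..1}" using sets_eq_imp_space_eq[OF M(2)] by (simp add: space_restrict_space)
  show "B \<inter> {0..1} \<in> sets M" if "B \<in> sets borel" using that M(2) by (auto simp: sets_restrict_space)
qed

text \<open>A first-moment argument: by invariance the number of visits before time \<open>N\<close>
  has integral \<open>N\<close> times the measure of \<open>B\<close>, so it cannot lie strictly
  below that value everywhere. Periodicity of \<open>B\<close> allows \<open>a^k * x\<close> in
  place of the iterates of \<open>times_map a\<close>.\<close>

lemma ex_frequent_visits:
  fixes N :: nat
  assumes M: "borel_prob_unit_interval M" and inv: "invariant_measure (times_map a) M"
    and B: "B \<in> sets borel" and per: "\<And>x m. x \<in> B \<Longrightarrow> x + of_int m \<in> B"
    and "N > 0"
  shows "\<exists>x. N * measure M (B \<inter> {0..1}) \<le> card {k. k < N \<and> real a ^ k * x \<in> B}"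
proof (rule ccontr)
  interpret prob_space M using borel_prob_unit_intervalD[OF M] by auto
  let ?A = "B \<inter> {0..1}"
  have A: "?A \<in> sets M" using borel_prob_unit_intervalD(3)[OF M B] .
  define E where "E k = (times_map a ^^ k) -` ?A \<inter> space M" for k
  have E: "E k \<in> sets M" "measure M (E k) = measure M ?A" for k
    using invariant_measure_funpow[OF inv A, of k] unfolding E_def measure_def by auto
  have EB: "x \<in> E k \<Longrightarrow> real a ^ k * x \<in> B" for x k
  proof -
    assume x: "x \<in> E k"
    obtain n where "(times_map a ^^ k) x - real a ^ k * x = of_int n"
      using times_map_funpow Ints_cases by metis
    then have eq: "real a ^ k * x = (times_map a ^^ k) x + of_int (- n)" by simp
    show ?thesis unfolding eq by (rule per) (use x in \<open>auto simp: E_def\<close>)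
  qed
  assume neg: "\<nexists>x. N * measure M ?A \<le> card {k. k < N \<and> real a ^ k * x \<in> B}"
  let ?f = "\<lambda>x. \<Sum>k<N. indicat_real (E k) x"
  have int: "integrable M ?f" using E by (intro Bochner_Integration.integrable_sum) (auto simp: emeasure_eq_measure)
  have "integral\<^sup>L M ?f = (\<Sum>k<N. measure M (E k))" using E by (subst Bochner_Integration.integral_sum) (auto simp: emeasure_eq_measure)
  then have I: "integral\<^sup>L M ?f = N * measure M ?A" using E by simp
  have lt: "?f x < N * measure M ?A" for x
  proof -
    have "?f x = (\<Sum>k\<in>{k. k < N \<and> x \<in> E k}. 1)"
      by (rule sum.mono_neutral_cong_right) (auto simp: indicator_def)
    also have "\<dots> = card {k. k < N \<and> x \<in> E k}" by simp
    also have "\<dots> \<le> card {k. k < N \<and> real a ^ k * x \<in> B}" using EB by (intro of_nat_mono card_mono) auto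
    also have "\<dots> < N * measure M ?A" using neg by (meson not_le)
    finally show ?thesis .
  qed
  have "integral\<^sup>L M ?f < integral\<^sup>L M (\<lambda>x. N * measure M ?A)"
    using int lt by (intro integral_less_AE_space) (auto simp: emeasure_space_1)
  then show False using I by (simp add: prob_space)
qed

text \<open>Along an orbit visiting \<open>B\<close> with frequency at least
  \<open>\<delta>\<close>, the first visited point is perturbed to a \<open>y'\<close> carrying a
  tiny nonzero \<open>e\<close> with \<open>(y', e)\<close> in \<open>S\<close>. At fewer than
  \<open>\<delta> * N\<close> times does \<open>a^k * e\<close> miss \<open>hits b U\<close>, so at
  some visit it does not. Multiplying by a power of \<open>b\<close> and shifting by integers then
  lands in \<open>V\<close> and \<open>U\<close>.\<close>

lemma skew_invariant_dense_values:
  assumes a: "a \<ge> 2" and b: "b \<ge> 2" and ind: "mult_indep a b"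
    and M: "borel_prob_unit_interval M" and inv: "invariant_measure (times_map a) M"
    and S: "skew_invariant a b S" and V: "open V" and U: "open U" "U \<noteq> {}"
    and pos: "emeasure M (V \<inter> vertical_acc S \<inter> {0..1}) > 0"
  shows "\<exists>x\<in>V. \<exists>t\<in>U. (x, t) \<in> S"
proof -
  interpret prob_space M using borel_prob_unit_intervalD[OF M] by auto
  define V' where "V' = (\<Union>m::int. (\<lambda>y. y + of_int m) -` V)"
  have V': "open V'" unfolding V'_def using V by (intro open_UN ballI open_vimage) (auto intro: continuous_intros)
  have V'per: "x + of_int m \<in> V'" if x: "x \<in> V'" for x m
  proof -
    obtain n :: int where "x + of_int n \<in> V" using x unfolding V'_def by auto
    then have "(x + of_int m) + of_int (n - m) \<in> V" by simp
    then show ?thesis unfolding V'_def by blast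
  qed
  define B where "B = V' \<inter> vertical_acc S"
  have B: "B \<in> sets borel" unfolding B_def using V' closed_vertical_acc by (auto intro: borel_open borel_closed)
  have VV': "V \<subseteq> V'" unfolding V'_def by (auto intro!: exI[of _ 0])
  define \<delta> where "\<delta> = measure M (B \<inter> {0..1})"
  have "B \<inter> {0..1} \<in> sets M" using borel_prob_unit_intervalD(3)[OF M B] .
  then have "emeasure M (V \<inter> vertical_acc S \<inter> {0..1}) \<le> emeasure M (B \<inter> {0..1})"
    unfolding B_def using VV' by (intro emeasure_mono) auto
  then have \<delta>: "\<delta> > 0" unfolding \<delta>_def using pos by (simp add: emeasure_eq_measure)
  \<comment> \<open>The perturbation \<open>e\<close> may be negative, whereas
    \<open>count_missing\<close> concerns positive numbers. That case is handled by reflecting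
    \<open>U\<close>.\<close>
  have U': "open (uminus ` U)" "uminus ` U \<noteq> {}" using U by (auto intro: open_negations)
  obtain N1 :: nat where N1: "\<forall>N\<ge>N1. \<forall>e>0. real a ^ N * e \<le> 1 \<longrightarrow> card {k. k < N \<and> real a ^ k * e \<notin> hits b U} < \<delta> * N"
    using count_missing[OF a b ind U \<delta>] ..
  obtain N2 :: nat where N2: "\<forall>N\<ge>N2. \<forall>e>0. real a ^ N * e \<le> 1 \<longrightarrow> card {k. k < N \<and> real a ^ k * e \<notin> hits b (uminus ` U)} < \<delta> * N"
    using count_missing[OF a b ind U' \<delta>] ..
  \<comment> \<open>\<open>N\<close> is fixed before \<open>e\<close>, which will be chosen smaller
    than \<open>1/a^N\<close>. The successor makes \<open>N\<close> positive.\<close>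
  define N where "N = Suc (max N1 N2)"
  obtain x where x: "N * \<delta> \<le> card {k. k < N \<and> real a ^ k * x \<in> B}"
    using ex_frequent_visits[OF M inv B, of N] V'per vertical_acc_shift[OF S]
    unfolding \<delta>_def B_def N_def by blast
  define R where "R = {k. k < N \<and> real a ^ k * x \<in> B}"
  have finR: "finite R" unfolding R_def by simp
  have "R \<noteq> {}"
  proof
    assume "R = {}"
    then have "real N * \<delta> \<le> 0" using x unfolding R_def by (metis card.empty of_nat_0)
    moreover have "0 < real N * \<delta>" using \<delta> unfolding N_def by (intro mult_pos_pos) auto
    ultimately show False by linarith
  qed
  \<comment> \<open>Starting at the first visit makes all differences \<open>k - k0\<close> natural
    numbers below \<open>N\<close>, distinct for distinct visits, so the visit count is
    preserved.\<close>
  define k0 where "k0 = Min R"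
  have k0: "k0 \<in> R" "\<And>k. k \<in> R \<Longrightarrow> k0 \<le> k" unfolding k0_def using finR \<open>R \<noteq> {}\<close> by auto
  define y where "y = real a ^ k0 * x"
  have yacc: "y \<in> vertical_acc S" using k0 unfolding y_def R_def B_def by auto
  \<comment> \<open>Every point of this neighbourhood of \<open>y\<close> follows \<open>y\<close>
    into \<open>V'\<close> at all the finitely many visit times.\<close>
  define Q where "Q = (\<Inter>k\<in>R. (\<lambda>z. real a ^ (k - k0) * z) -` V')"
  have "open Q" unfolding Q_def using finR V' by (intro open_INT ballI open_vimage) (auto intro: continuous_intros)
  moreover have "y \<in> Q"
  proof -
    have "real a ^ (k - k0) * y \<in> V'" if "k \<in> R" for k
    proof -
      have "real a ^ (k - k0) * y = real a ^ k * x"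
        unfolding y_def using k0(2)[OF that] by (simp add: mult.assoc[symmetric] power_add[symmetric])
      then show ?thesis using that unfolding R_def B_def by auto
    qed
    then show ?thesis unfolding Q_def by auto
  qed
  moreover have "1 / real a ^ N > 0" using a by simp
  ultimately obtain y' e where ye: "y' \<in> Q" "(y', e) \<in> S" "e \<noteq> 0" "\<bar>e\<bar> < 1 / real a ^ N"
    using yacc unfolding vertical_acc_iff by meson
  have small: "real a ^ N * \<bar>e\<bar> \<le> 1" using ye(4) a by (simp add: field_simps)
  have shiftR: "card R \<le> card ((\<lambda>k. k - k0) ` R)"
    using k0(2) by (subst card_image) (auto intro!: inj_on_diff_nat)
  have "\<exists>k\<in>R. real a ^ (k - k0) * e \<in> hits b U"
  proof (rule ccontr)
    assume none: "\<not> ?thesis"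
    show False
    proof (cases "e > 0")
      case True
      have "(\<lambda>k. k - k0) ` R \<subseteq> {k. k < N \<and> real a ^ k * e \<notin> hits b U}"
        using none unfolding R_def by auto
      then have "card R \<le> card {k. k < N \<and> real a ^ k * e \<notin> hits b U}"
        using shiftR card_mono[of "{k. k < N \<and> real a ^ k * e \<notin> hits b U}" "(\<lambda>k. k - k0) ` R"] by simp
      moreover have "card {k. k < N \<and> real a ^ k * e \<notin> hits b U} < \<delta> * N"
        using N1[rule_format, of N e] True small by (simp add: N_def)
      ultimately show False using x unfolding R_def by (simp add: mult.commute)
    next
      case False
      then have e: "\<bar>e\<bar> = - e" "- e > 0" using ye(3) by auto
      have neg: "t \<in> hits b U" if t: "- t \<in> hits b (uminus ` U)" for t
      proof -
        obtain j n u where u: "u \<in> U" "real b ^ j * (- t) + of_int n = - u"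
          using t unfolding hits_def by blast
        then have "real b ^ j * t + of_int (- n) = u" by simp
        then have "real b ^ j * t + of_int (- n) \<in> U" using u(1) by simp
        then show ?thesis unfolding hits_def by blast
      qed
      have "(\<lambda>k. k - k0) ` R \<subseteq> {k. k < N \<and> real a ^ k * (- e) \<notin> hits b (uminus ` U)}"
        using none neg unfolding R_def by auto
      then have "card R \<le> card {k. k < N \<and> real a ^ k * (- e) \<notin> hits b (uminus ` U)}"
        using shiftR card_mono[of "{k. k < N \<and> real a ^ k * (- e) \<notin> hits b (uminus ` U)}" "(\<lambda>k. k - k0) ` R"] by simp
      moreover have "card {k. k < N \<and> real a ^ k * (- e) \<notin> hits b (uminus ` U)} < \<delta> * N"
        using N2[rule_format, of N "- e"] e small by (simp add: N_def)
      ultimately show False using x unfolding R_def by (simp add: mult.commute)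
    qed
  qed
  then obtain k j n where k: "k \<in> R" "real b ^ j * (real a ^ (k - k0) * e) + of_int n \<in> U"
    unfolding hits_def by blast
  have "real a ^ (k - k0) * y' \<in> V'" using ye(1) k(1) unfolding Q_def by auto
  then obtain m :: int where m: "real a ^ (k - k0) * y' + of_int m \<in> V" unfolding V'_def by auto
  have "(real a ^ (k - k0) * y', real a ^ (k - k0) * e) \<in> S" using skew_invariantD(1)[OF S ye(2)] .
  then have "(real a ^ (k - k0) * y', real b ^ j * (real a ^ (k - k0) * e)) \<in> S" by (rule skew_invariantD(2)[OF S])
  then have "(real a ^ (k - k0) * y' + of_int m, real b ^ j * (real a ^ (k - k0) * e) + of_int n) \<in> S"
    by (rule skew_invariantD(3)[OF S])
  then show ?thesis using m k(2) by blast
qed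

section \<open>Topology of the hitting sets and of fibres\<close>

lemma hits_open: "open U \<Longrightarrow> open (hits b U)"
proof -
  assume U: "open U"
  have "hits b U = (\<Union>(j::nat). \<Union>(n::int). (\<lambda>t. real b ^ j * t + of_int n) -` U)"
    unfolding hits_def by auto
  then show ?thesis using U by (auto intro!: open_UN open_vimage continuous_intros)
qed

lemma hits_dense:
  assumes b: "b \<ge> 2" and U: "open U" "U \<noteq> {}" and Q: "open Q" "Q \<noteq> {}"
  shows "Q \<inter> hits b U \<noteq> {}"
proof -
  obtain c where "c \<in> Q" using Q by blast
  then obtain \<eta> where \<eta>: "\<eta> > 0" "ball c \<eta> \<subseteq> Q" using Q openE by blast
  obtain u where u: "u \<in> U" using U by blast
  obtain j where j: "(1 / real b)^j < \<eta>"
    using real_arch_pow_inv[OF \<eta>(1), of "1 / real b"] b by auto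
  define n where "n = \<lfloor>u - real b ^ j * c\<rfloor>"
  define t where "t = (u - n) / real b ^ j"
  have bj: "real b ^ j > 0" using b by simp
  have t: "real b ^ j * t + of_int n = u" unfolding t_def using b by simp
  have "real b ^ j * (t - c) = u - real b ^ j * c - of_int n" using t by (simp add: algebra_simps)
  then have "\<bar>real b ^ j * (t - c)\<bar> \<le> 1" unfolding n_def by linarith
  then have "real b ^ j * \<bar>t - c\<bar> \<le> 1" by (simp add: abs_mult)
  then have "\<bar>t - c\<bar> \<le> 1 / real b ^ j" using bj by (simp add: pos_le_divide_eq mult.commute)
  then have "t \<in> ball c \<eta>" using j by (simp add: dist_real_def power_one_over)
  moreover have "t \<in> hits b U" unfolding hits_def using t u by blast
  ultimately show ?thesis using \<eta> by blast
qed

text \<open>Translates of the open dense set \<open>hits b U\<close> are open and dense, and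
  finitely many of them meet in a nonempty open set.\<close>

lemma hits_common_shifts:
  fixes q :: real
  assumes b: "b \<ge> 2" and U: "open U" "U \<noteq> {}"
  shows "\<exists>Q. open Q \<and> Q \<noteq> {} \<and> (\<forall>t\<in>Q. \<forall>p<k. real p / q + t \<in> hits b U)"
proof (induction k)
  case 0 show ?case by (intro exI[of _ UNIV]) auto
next
  case (Suc k)
  then obtain Q where Q: "open Q" "Q \<noteq> {}" "\<forall>t\<in>Q. \<forall>p<k. real p / q + t \<in> hits b U" by blast
  define Q' where "Q' = (\<lambda>t. t - real k / q) -` Q"
  have Q': "open Q'" unfolding Q'_def using Q by (auto intro!: open_vimage continuous_intros)
  obtain t where "t \<in> Q" using Q by blast
  then have "t + real k / q \<in> Q'" unfolding Q'_def by simp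
  then obtain s where s: "s \<in> Q'" "s \<in> hits b U" using hits_dense[OF b U Q'] by blast
  define R where "R = Q \<inter> (\<lambda>t. real k / q + t) -` hits b U"
  have "open R" unfolding R_def using Q hits_open[OF U(1)] by (auto intro!: open_Int open_vimage continuous_intros)
  moreover have "s - real k / q \<in> R" using s unfolding R_def Q'_def by simp
  moreover have "\<forall>t\<in>R. \<forall>p<Suc k. real p / q + t \<in> hits b U"
    using Q unfolding R_def by (auto simp: less_Suc_eq)
  ultimately show ?case by blast
qed

lemma hits_int_shift: "t + of_int n \<in> hits b U \<longleftrightarrow> t \<in> hits b U"
proof -
  have *: "t + of_int n \<in> hits b U" if t: "t \<in> hits b U" for t n
  proof -
    obtain j m where "real b ^ j * t + of_int m \<in> U" using t unfolding hits_def by blast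
    then have "real b ^ j * (t + of_int n) + of_int (m - int b ^ j * n) \<in> U"
      by (simp add: algebra_simps)
    then show ?thesis unfolding hits_def by blast
  qed
  from *[of t n] *[of "t + of_int n" "- n"] show ?thesis by auto
qed

text \<open>Periodicity lets \<open>z\<close> be taken in the compact unit interval, and projecting
  a closed set along a compact factor preserves closedness.\<close>

lemma closed_vertical_differences:
  fixes Y :: "(real \<times> real) set"
  assumes Y: "closed Y" and per: "\<And>x z n. (x, z) \<in> Y \<Longrightarrow> (x, z + of_int n) \<in> Y"
  shows "closed {(x, e). \<exists>z. (x, z) \<in> Y \<and> (x, z + e) \<in> Y}"
proof -
  let ?A = "{(z, p). (fst p, z) \<in> Y \<and> (fst p, z + snd p) \<in> Y}"
  have "?A = (\<lambda>w. (fst (snd w), fst w)) -` Y \<inter> (\<lambda>w. (fst (snd w), fst w + snd (snd w))) -` Y" by auto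
  then have A: "closed ?A" using Y by (auto intro!: closed_Int closed_vimage continuous_intros)
  have "{(x, e). \<exists>z. (x, z) \<in> Y \<and> (x, z + e) \<in> Y} = {p. \<exists>z. z \<in> {0..1} \<and> (z, p) \<in> ?A}"
  proof (intro Set.set_eqI iffI)
    fix p assume "p \<in> {(x, e). \<exists>z. (x, z) \<in> Y \<and> (x, z + e) \<in> Y}"
    then obtain z where z: "(fst p, z) \<in> Y" "(fst p, z + snd p) \<in> Y" by auto
    have "(fst p, frac z) \<in> Y" "(fst p, frac z + snd p) \<in> Y"
      using per[OF z(1), of "- \<lfloor>z\<rfloor>"] per[OF z(2), of "- \<lfloor>z\<rfloor>"] by (simp_all add: frac_def algebra_simps)
    moreover have "frac z \<in> {0..1}" by (simp add: less_imp_le[OF frac_lt_1])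
    ultimately have "frac z \<in> {0..1} \<and> (frac z, p) \<in> ?A" by simp
    then show "p \<in> {p. \<exists>z. z \<in> {0..1} \<and> (z, p) \<in> ?A}" by blast
  qed auto
  moreover have "closed {p. \<exists>z. z \<in> {0..1} \<and> (z, p) \<in> ?A}"
    by (rule closed_compact_projection[OF compact_Icc A])
  ultimately show ?thesis by simp
qed

text \<open>The numbers \<open>b^n * z\<close> are distinct modulo 1, since a coincidence would make
  \<open>z\<close> rational. Their fractional parts thus form an infinite subset of the unit
  interval, which accumulates somewhere.\<close>

lemma irrational_fibre_differences:
  fixes F :: "real set"
  assumes b: "b \<ge> 2" and z: "z \<in> F" "z \<notin> \<rat>" and "\<And>z. z \<in> F \<Longrightarrow> real b * z \<in> F"
    and per: "\<And>z n. z \<in> F \<Longrightarrow> z + of_int n \<in> F" and "\<eta> > 0"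
  shows "\<exists>z1\<in>F. \<exists>z2\<in>F. z1 \<noteq> z2 \<and> \<bar>z2 - z1\<bar> < \<eta>"
proof -
  have bz: "real b ^ n * z \<in> F" for n
    by (induction n) (use assms in \<open>auto simp: mult.assoc\<close>)
  define g where "g n = frac (real b ^ n * z)" for n
  have g: "g n \<in> F" "g n \<in> {0..1}" for n
    using per[OF bz, of n "- \<lfloor>real b ^ n * z\<rfloor>"] unfolding g_def
    by (simp_all add: frac_def less_imp_le[OF frac_lt_1, unfolded frac_def])
  have "inj g"
  proof (rule linorder_injI)
    fix m n :: nat assume mn: "m < n"
    show "g m \<noteq> g n"
    proof
      assume "g m = g n"
      then have "(real b ^ n - real b ^ m) * z = of_int (\<lfloor>real b ^ n * z\<rfloor> - \<lfloor>real b ^ m * z\<rfloor>)"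
        unfolding g_def frac_def by (simp add: algebra_simps)
      moreover have "real b ^ n - real b ^ m \<noteq> 0" using b mn by simp
      ultimately have "z = of_int (\<lfloor>real b ^ n * z\<rfloor> - \<lfloor>real b ^ m * z\<rfloor>) / (real b ^ n - real b ^ m)"
        by (simp add: field_simps)
      also have "\<dots> \<in> \<rat>" by (intro Rats_divide Rats_diff Rats_of_int Rats_power Rats_of_nat)
      finally show False using z by simp
    qed
  qed
  then have "infinite (range g)" using finite_imageD infinite_UNIV_nat by blast
  moreover have "range g \<subseteq> {0..1}" using g by blast
  ultimately obtain w where w: "w islimpt range g"
    using Heine_Borel_imp_Bolzano_Weierstrass[of "{0..1::real}"] by (meson compact_Icc)
  then obtain z1 where z1: "z1 \<in> range g" "z1 \<noteq> w" "dist z1 w < \<eta>/2"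
    unfolding islimpt_approachable using \<open>\<eta> > 0\<close> by (meson half_gt_zero)
  then obtain z2 where z2: "z2 \<in> range g" "z2 \<noteq> w" "dist z2 w < min (\<eta>/2) (dist z1 w)"
    using w unfolding islimpt_approachable using \<open>\<eta> > 0\<close> by (metis half_gt_zero min_less_iff_conj zero_less_dist_iff)
  have "z1 \<noteq> z2" using z2 by auto
  moreover have "\<bar>z2 - z1\<bar> < \<eta>" using z1(3) z2(3) unfolding dist_real_def by linarith
  ultimately show ?thesis using z1 z2 g by blast
qed

section \<open>Constructions preserving skew invariance\<close>

lemma skew_invariantI:
  assumes "\<And>x t. (x, t) \<in> S \<Longrightarrow> (a * x, a * t) \<in> S" "\<And>x t. (x, t) \<in> S \<Longrightarrow> (x, b * t) \<in> S"
    "\<And>x t m n. (x, t) \<in> S \<Longrightarrow> (x + of_int m, t + of_int n) \<in> S"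
  shows "skew_invariant a b S"
  using assms unfolding skew_invariant_def by blast

lemma skew_invariant_closure:
  assumes S: "skew_invariant a b S"
  shows "skew_invariant a b (closure S)"
proof -
  have *: "f p \<in> closure S" if "continuous_on UNIV f" "\<And>p. p \<in> S \<Longrightarrow> f p \<in> S" "p \<in> closure S" for f p
    using image_closure_subset[of S f "closure S"] that closure_subset continuous_on_subset by blast
  show ?thesis
  proof (rule skew_invariantI)
    fix x t :: real assume xt: "(x, t) \<in> closure S"
    have "continuous_on UNIV (\<lambda>p::real \<times> real. (a * fst p, a * snd p))"
      by (intro continuous_intros)
    from *[OF this _ xt] show "(a * x, a * t) \<in> closure S"
      using S by (auto simp: skew_invariant_def)
    have "continuous_on UNIV (\<lambda>p::real \<times> real. (fst p, b * snd p))"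
      by (intro continuous_intros)
    from *[OF this _ xt] show "(x, b * t) \<in> closure S"
      using S by (auto simp: skew_invariant_def)
    fix m n
    have "continuous_on UNIV (\<lambda>p::real \<times> real. (fst p + of_int m, snd p + of_int n))"
      by (intro continuous_intros)
    from *[OF this _ xt] show "(x + of_int m, t + of_int n) \<in> closure S"
      using S by (auto simp: skew_invariant_def)
  qed
qed

lemma skew_invariant_differences:
  assumes S: "skew_invariant a b S"
  shows "skew_invariant a b {(x, e). \<exists>z. (x, z) \<in> S \<and> (x, z + e) \<in> S}"
proof (rule skew_invariantI)
  fix x e :: real assume "(x, e) \<in> {(x, e). \<exists>z. (x, z) \<in> S \<and> (x, z + e) \<in> S}"
  then obtain z where z: "(x, z) \<in> S" "(x, z + e) \<in> S" by auto
  have "(a * x, a * z) \<in> S \<and> (a * x, a * z + a * e) \<in> S"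
    using skew_invariantD(1)[OF S z(1), of 1] skew_invariantD(1)[OF S z(2), of 1] by (simp add: algebra_simps)
  then show "(a * x, a * e) \<in> {(x, e). \<exists>z. (x, z) \<in> S \<and> (x, z + e) \<in> S}" by blast
  have "(x, b * z) \<in> S \<and> (x, b * z + b * e) \<in> S"
    using skew_invariantD(2)[OF S z(1), of 1] skew_invariantD(2)[OF S z(2), of 1] by (simp add: algebra_simps)
  then show "(x, b * e) \<in> {(x, e). \<exists>z. (x, z) \<in> S \<and> (x, z + e) \<in> S}" by blast
  fix m n
  have "(x + of_int m, z) \<in> S \<and> (x + of_int m, z + (e + of_int n)) \<in> S"
    using skew_invariantD(3)[OF S z(1), of m 0] skew_invariantD(3)[OF S z(2), of m n] by (simp add: algebra_simps)
  then show "(x + of_int m, e + of_int n) \<in> {(x, e). \<exists>z. (x, z) \<in> S \<and> (x, z + e) \<in> S}" by blast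
qed

lemma skew_invariant_rational_shift:
  fixes q :: nat
  assumes S: "skew_invariant a b S"
  shows "skew_invariant a b {(x, e). \<exists>p::int. (x, p / q + e) \<in> S}"
proof (rule skew_invariantI)
  fix x e :: real assume "(x, e) \<in> {(x, e). \<exists>p::int. (x, p / q + e) \<in> S}"
  then obtain p :: int where p: "(x, p / q + e) \<in> S" by auto
  have "(a * x, of_int (a * p) / q + a * e) \<in> S"
    using skew_invariantD(1)[OF S p, of 1] by (simp add: algebra_simps)
  then show "(a * x, a * e) \<in> {(x, e). \<exists>p::int. (x, p / q + e) \<in> S}" by blast
  have "(x, of_int (b * p) / q + b * e) \<in> S"
    using skew_invariantD(2)[OF S p, of 1] by (simp add: algebra_simps)
  then show "(x, b * e) \<in> {(x, e). \<exists>p::int. (x, p / q + e) \<in> S}" by blast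
  fix m n
  have "(x + of_int m, p / q + (e + of_int n)) \<in> S"
    using skew_invariantD(3)[OF S p, of m n] by (simp add: algebra_simps)
  then show "(x + of_int m, e + of_int n) \<in> {(x, e). \<exists>p::int. (x, p / q + e) \<in> S}" by blast
qed

text \<open>With \<open>a\<close> and \<open>b\<close> congruent to 1 modulo \<open>q\<close>, both
  multiplications fix each \<open>l/q\<close> modulo 1, so they commute with these translations up
  to integers.\<close>

lemma skew_invariant_progression:
  fixes q :: nat
  assumes S: "skew_invariant a b S" and q: "q > 0" "int q dvd int a - 1" "int q dvd int b - 1"
  shows "skew_invariant a b {(x, z). \<forall>l\<le>i. (x, z + real l / q) \<in> S}"
proof (rule skew_invariantI)
  fix x z :: real assume "(x, z) \<in> {(x, z). \<forall>l\<le>i. (x, z + real l / q) \<in> S}"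
  then have z: "(x, z + real l / q) \<in> S" if "l \<le> i" for l :: nat using that by auto
  have shift: "c * (z + real l / q) + of_int (- (d * int l)) = c * z + real l / q"
    if "int c - 1 = int q * d" for c l :: nat and d
  proof -
    have "real c = 1 + q * of_int d" using that
      by (metis add.commute diff_add_cancel of_int_1 of_int_add of_int_mult of_int_of_nat_eq)
    then show ?thesis using q(1) by (simp add: field_simps)
  qed
  obtain da where da: "int a - 1 = int q * da" using q by (auto elim: dvdE)
  obtain db where db: "int b - 1 = int q * db" using q by (auto elim: dvdE)
  show "(a * x, a * z) \<in> {(x, z). \<forall>l\<le>i. (x, z + real l / q) \<in> S}"
  proof clarify
    fix l assume "l \<le> i"
    then show "(a * x, a * z + real l / q) \<in> S"
      using skew_invariantD(3)[OF S skew_invariantD(1)[OF S z, of l 1], of 0 "- (da * int l)"] shift[OF da]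
      by simp
  qed
  show "(x, b * z) \<in> {(x, z). \<forall>l\<le>i. (x, z + real l / q) \<in> S}"
  proof clarify
    fix l assume "l \<le> i"
    then show "(x, b * z + real l / q) \<in> S"
      using skew_invariantD(3)[OF S skew_invariantD(2)[OF S z, of l 1], of 0 "- (db * int l)"] shift[OF db]
      by simp
  qed
  show "(x + of_int m, z + of_int n) \<in> {(x, z). \<forall>l\<le>i. (x, z + real l / q) \<in> S}" for m n
    using skew_invariantD(3)[OF S z, of _ m n] by (auto simp: algebra_simps)
qed

section \<open>The graph of the orbits under multiplication by \<open>b\<close>\<close>

definition orbit_graph :: "nat \<Rightarrow> real set \<Rightarrow> (real \<times> real) set" where
  "orbit_graph b X = {(x, z). (\<exists>n m. z = real b ^ n * x + of_int m) \<and> (\<exists>k. x + of_int k \<in> X)}"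

lemma orbit_graphI:
  "z = real b ^ n * x + of_int m \<Longrightarrow> x + of_int k \<in> X \<Longrightarrow> (x, z) \<in> orbit_graph b X"
  unfolding orbit_graph_def by auto

lemma orbit_graphE:
  assumes "(x, z) \<in> orbit_graph b X"
  obtains n m k where "z = real b ^ n * x + of_int m" "x + of_int k \<in> X"
  using assms unfolding orbit_graph_def by auto

lemma skew_invariant_orbit_graph:
  assumes TX: "times_map a ` X \<subseteq> X"
  shows "skew_invariant a b (orbit_graph b X)"
proof (rule skew_invariantI)
  fix x z assume "(x, z) \<in> orbit_graph b X"
  then obtain n m k where z: "z = real b ^ n * x + of_int m" and k: "x + of_int k \<in> X"
    by (rule orbit_graphE)
  have "times_map a (x + of_int k) \<in> X" using k TX by blast
  then have "a * x + of_int (a * k - \<lfloor>a * (x + of_int k)\<rfloor>) \<in> X"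
    by (simp add: times_map_def frac_def algebra_simps)
  moreover have "a * z = real b ^ n * (a * x) + of_int (a * m)" by (simp add: z algebra_simps)
  ultimately show "(a * x, a * z) \<in> orbit_graph b X" by (intro orbit_graphI)
  have "b * z = real b ^ Suc n * x + of_int (b * m)" by (simp add: z algebra_simps)
  then show "(x, b * z) \<in> orbit_graph b X" using k by (rule orbit_graphI)
  fix i j
  have "z + of_int j = real b ^ n * (x + of_int i) + of_int (m + j - int b ^ n * i)"
    by (simp add: z algebra_simps)
  moreover have "(x + of_int i) + of_int (k - i) \<in> X" using k by simp
  ultimately show "(x + of_int i, z + of_int j) \<in> orbit_graph b X" by (rule orbit_graphI)
qed

text \<open>The open set \<open>V \<times> U\<close> meets the graph itself. Keeping
  \<open>V\<close> inside the open unit interval excludes the identification of 0 with 1, so a base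
  point lying in \<open>X\<close> up to an integer lies in \<open>X\<close> itself.\<close>

lemma closure_orbit_graph_hits:
  assumes X: "X \<subseteq> {0..1}" and V: "open V" "V \<subseteq> {0<..<1}" and U: "open U"
    and xz: "(x, z) \<in> closure (orbit_graph b X)" "x \<in> V" "z \<in> U"
  shows "\<exists>x\<in>V \<inter> X. x \<in> hits b U"
proof -
  have "open (V \<times> U)" using U V by (simp add: open_Times)
  then have "(V \<times> U) \<inter> orbit_graph b X \<noteq> {}"
    using xz open_Int_closure_eq_empty[of "V \<times> U"] by blast
  then obtain y w where yw: "y \<in> V" "w \<in> U" "(y, w) \<in> orbit_graph b X" by auto
  from yw(3) obtain n m k where y: "w = real b ^ n * y + of_int m" "y + of_int k \<in> X"
    by (rule orbit_graphE)
  have "y \<in> {0<..<1}" "y + of_int k \<in> {0..1}" using y yw V X by blast+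
  then have "0 < y" "y < 1" "0 \<le> y + of_int k" "y + of_int k \<le> 1" by auto
  then have "k = 0" by linarith
  then show ?thesis using y yw unfolding hits_def by auto
qed

section \<open>Density along an invariant measure\<close>

text \<open>The support and non-atomicity assumptions are reduced to \<open>pos\<close> and
  \<open>null_singleton\<close>. In this form everything passes to the powers \<open>a^m\<close> and
  \<open>b^m\<close> with the same \<open>M\<close> and \<open>X\<close>.\<close>

locale nonatomic_support =
  fixes a b :: nat and M :: "real measure" and X :: "real set"
  assumes a: "a \<ge> 2" and b: "b \<ge> 2" and ind: "mult_indep a b"
    and M: "borel_prob_unit_interval M" and inv: "invariant_measure (times_map a) M"
    and X: "X \<subseteq> {0..1}" and TX: "times_map a ` X \<subseteq> X"
    and pos: "\<And>Q. open Q \<Longrightarrow> Q \<inter> X \<noteq> {} \<Longrightarrow> emeasure M (Q \<inter> X) > 0"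
    and null_singleton: "\<And>x. emeasure M {x} = 0"
begin

abbreviation "W \<equiv> closure (orbit_graph b X)"

lemma W: "skew_invariant a b W" "closed W"
  using skew_invariant_closure[OF skew_invariant_orbit_graph[OF TX]] by auto

lemma sets_M: "B \<in> sets borel \<Longrightarrow> B \<inter> {0..1} \<in> sets M"
  using borel_prob_unit_intervalD(3)[OF M] .

text \<open>Graph points near \<open>(x, p/q)\<close> might have the value \<open>p/q\<close>
  exactly, which would give \<open>e = 0\<close>. The base point can then be moved: nearby points of
  \<open>X\<close> carry positive mass, so they are not confined to a single null point.\<close>

lemma rational_in_vertical_acc:
  fixes p :: int and q :: nat
  assumes p: "(x, p / q) \<in> W"
  shows "x \<in> vertical_acc {(x, e). \<exists>p::int. (x, p / q + e) \<in> W}"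
  unfolding vertical_acc_iff
proof (intro allI impI)
  fix Q and \<eta> :: real assume Q: "open Q" "x \<in> Q" and \<eta>: "\<eta> > 0"
  have "open (Q \<times> ball (p / q) \<eta>)" using Q by (simp add: open_Times)
  moreover have "(x, p / q) \<in> Q \<times> ball (p / q) \<eta>" using Q \<eta> by simp
  ultimately have "(Q \<times> ball (p / q) \<eta>) \<inter> orbit_graph b X \<noteq> {}"
    using p open_Int_closure_eq_empty[of "Q \<times> ball (p / q) \<eta>"] by blast
  then obtain y w where yw: "y \<in> Q" "w \<in> ball (p / q) \<eta>" "(y, w) \<in> orbit_graph b X" by auto
  from yw(3) obtain n m k where w: "w = real b ^ n * y + of_int m" "y + of_int k \<in> X"
    by (rule orbit_graphE)
  with yw have y: "y \<in> Q" "real b ^ n * y + of_int m \<in> ball (p / q) \<eta>" "y + of_int k \<in> X" by auto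
  define R where "R = (\<lambda>y. y - of_int k) -` (Q \<inter> (\<lambda>y. real b ^ n * y + of_int m) -` ball (p / q) \<eta>)"
  have "open R" unfolding R_def using Q(1) by (intro open_vimage open_Int) (auto intro!: continuous_intros)
  moreover have "y + of_int k \<in> R \<inter> X" using y unfolding R_def by auto
  ultimately have R: "emeasure M (R \<inter> X) > 0" using pos by blast
  \<comment> \<open>The chosen affine branch takes the value \<open>p/q\<close> at a single point;
    \<open>s\<close> is that point translated by \<open>k\<close>.\<close>
  define s where "s = (p / q - of_int m) / real b ^ n + of_int k"
  have "\<not> R \<inter> X \<subseteq> {s}"
  proof
    assume "R \<inter> X \<subseteq> {s}"
    then have "R \<inter> X = {} \<or> R \<inter> X = {s}" by blast
    then show False using R null_singleton[of s] by auto
  qed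
  then obtain u where u: "u \<in> R" "u \<in> X" "u \<noteq> s" by blast
  define y' where "y' = u - of_int k"
  have y': "y' \<in> Q" "real b ^ n * y' + of_int m \<in> ball (p / q) \<eta>" "y' + of_int k \<in> X"
    using u unfolding R_def y'_def by auto
  have ne: "real b ^ n * y' + of_int m \<noteq> p / q"
  proof
    assume "real b ^ n * y' + of_int m = p / q"
    then have "real b ^ n * y' = p / q - of_int m" by linarith
    then have "y' = (p / q - of_int m) / real b ^ n" using b by (simp add: eq_divide_eq mult.commute)
    then show False using u(3) unfolding s_def y'_def by simp
  qed
  have "(y', real b ^ n * y' + of_int m) \<in> W"
    using orbit_graphI[OF refl y'(3)] closure_subset by blast
  then have "(y', p / q + (real b ^ n * y' + of_int m - p / q)) \<in> W" by simp
  moreover have "real b ^ n * y' + of_int m - p / q \<noteq> 0" using ne by simp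
  moreover have "\<bar>real b ^ n * y' + of_int m - p / q\<bar> < \<eta>" using y'(2) by (simp add: dist_real_def abs_minus_commute)
  ultimately show "\<exists>y\<in>Q. \<exists>e. (y, e) \<in> {(x, e). \<exists>p::int. (x, p / q + e) \<in> W} \<and> e \<noteq> 0 \<and> \<bar>e\<bar> < \<eta>"
    using y'(1) by blast
qed

text \<open>Otherwise the engine gives a point \<open>(x, r/q + t)\<close> of \<open>W\<close> with
  an unknown numerator \<open>r\<close>. The open set \<open>Q\<close> of values \<open>t\<close> is
  chosen beforehand so that \<open>r/q + t\<close> lies in \<open>hits b U\<close> for every
  \<open>r\<close>, against \<open>miss\<close>.\<close>

lemma rational_fibre_null:
  fixes q :: nat
  assumes q: "q > 0" and V: "open V" "V \<subseteq> {0<..<1}" and U: "open U" "U \<noteq> {}"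
    and miss: "\<not> (\<exists>x\<in>V \<inter> X. x \<in> hits b U)"
  shows "emeasure M (V \<inter> vertical_acc {(x, e). \<exists>p::int. (x, p / q + e) \<in> W} \<inter> {0..1}) = 0"
proof (rule ccontr)
  let ?S = "{(x, e). \<exists>p::int. (x, p / q + e) \<in> W}"
  assume "\<not> ?thesis"
  then have p: "emeasure M (V \<inter> vertical_acc ?S \<inter> {0..1}) > 0" by (simp add: zero_less_iff_neq_zero)
  obtain Q where Q: "open Q" "Q \<noteq> {}" "\<forall>t\<in>Q. \<forall>p<q. real p / q + t \<in> hits b U"
    using hits_common_shifts[OF b U, of q q] by blast
  obtain x t where xt: "x \<in> V" "t \<in> Q" "(x, t) \<in> ?S"
    using skew_invariant_dense_values[OF a b ind M inv skew_invariant_rational_shift[OF W(1)] V(1) Q(1,2) p] by blast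
  then obtain r :: int where r: "(x, r / q + t) \<in> W" by blast
  define r' where "r' = nat (r mod int q)"
  have "r' < q" using q unfolding r'_def by (simp add: nat_less_iff)
  then have h: "real r' / q + t \<in> hits b U" using Q xt by blast
  have "r = int q * (r div int q) + int r'" using q unfolding r'_def by simp
  then have "real_of_int r = real_of_int (int q * (r div int q) + int r')" by (rule arg_cong)
  then have "real_of_int r = real q * real_of_int (r div int q) + real r'"
    by (simp only: of_int_add of_int_mult of_int_of_nat_eq)
  then have "r / q + t = (real r' / q + t) + of_int (r div int q)"
    using q by (simp add: field_simps)
  then have "r / q + t \<in> hits b U" using h hits_int_shift by metis
  then obtain j n where "real b ^ j * (r / q + t) + of_int n \<in> U" unfolding hits_def by blast
  moreover have "(x, real b ^ j * (r / q + t) + of_int n) \<in> W"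
    using skew_invariantD(3)[OF W(1) skew_invariantD(2)[OF W(1) r, of j], of 0 n] by simp
  ultimately show False using closure_orbit_graph_hits[OF X V U(1) _ xt(1)] miss by blast
qed

text \<open>Outside the null set \<open>N\<close> the fibres of \<open>Y\<close> over
  \<open>V \<inter> X\<close> contain irrationals only, hence pairs of distinct points at
  arbitrarily small distance. The engine, applied to the difference relation over small balls around
  \<open>x\<close>, gives differences near \<open>s\<close> over points near \<open>x\<close>.
  Closedness of that relation yields the exact statement.\<close>

lemma fibre_step:
  assumes V: "open V" "V \<subseteq> {0<..<1}" and U: "open U" "U \<noteq> {}"
    and miss: "\<not> (\<exists>x\<in>V \<inter> X. x \<in> hits b U)"
    and Y: "skew_invariant a b Y" "closed Y" "Y \<subseteq> W"
    and fib: "\<And>x. x \<in> V \<inter> X \<Longrightarrow> \<exists>z. (x, z) \<in> Y"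
    and x: "x \<in> V \<inter> X"
  shows "\<exists>z. (x, z) \<in> Y \<and> (x, z + s) \<in> Y"
proof -
  let ?S = "{(x, e). \<exists>z. (x, z) \<in> Y \<and> (x, z + e) \<in> Y}"
  let ?R = "\<lambda>q::nat. {(x, e). \<exists>p::int. (x, p / q + e) \<in> W}"
  \<comment> \<open>By \<open>rational_in_vertical_acc\<close>, this countable union contains every
    point of \<open>V \<inter> X\<close> over which \<open>W\<close> has a rational value.\<close>
  define N where "N = (\<Union>q\<in>{0<..}. V \<inter> vertical_acc (?R q) \<inter> {0..1})"
  have msb: "V \<inter> vertical_acc (?R q) \<inter> {0..1} \<in> sets M" for q
    using V closed_vertical_acc by (intro sets_M) (auto intro: borel_open borel_closed)
  have N: "N \<in> null_sets M" unfolding N_def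
    using rational_fibre_null[OF _ V U miss] msb
    by (intro null_sets_UN') (auto simp: null_sets_def)
  have S: "skew_invariant a b ?S" using skew_invariant_differences[OF Y(1)] .
  have clS: "closed ?S"
    using closed_vertical_differences[OF Y(2)] skew_invariantD(3)[OF Y(1), of _ _ 0] by simp
  have acc: "y \<in> vertical_acc ?S" if y: "y \<in> V \<inter> X" "y \<notin> N" for y
    unfolding vertical_acc_iff
  proof (intro allI impI)
    fix Q and \<eta> :: real assume Q: "open Q" "y \<in> Q" and \<eta>: "\<eta> > 0"
    obtain z where z: "(y, z) \<in> Y" using fib y by blast
    have irr: "z \<notin> \<rat>"
    proof
      assume "z \<in> \<rat>"
      then obtain p q :: int where pq: "q > 0" "z = p / q" by (metis Rats_cases')
      have "(y, p / nat q) \<in> W" using z pq Y(3) by auto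
      then have "y \<in> vertical_acc (?R (nat q))" by (rule rational_in_vertical_acc)
      then have "y \<in> N" unfolding N_def using y X pq by (intro UN_I[of "nat q"]) auto
      then show False using y by simp
    qed
    let ?F = "{z. (y, z) \<in> Y}"
    have "\<exists>z1\<in>?F. \<exists>z2\<in>?F. z1 \<noteq> z2 \<and> \<bar>z2 - z1\<bar> < \<eta>"
      using z skew_invariantD(2)[OF Y(1), of y _ 1] skew_invariantD(3)[OF Y(1), of y _ 0]
      by (intro irrational_fibre_differences[OF b _ irr]) (auto simp: \<eta>)
    then obtain z1 z2 where zz: "(y, z1) \<in> Y" "(y, z2) \<in> Y" "z1 \<noteq> z2" "\<bar>z2 - z1\<bar> < \<eta>" by auto
    then have "(y, z2 - z1) \<in> ?S" by (auto intro!: exI[of _ z1])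
    then show "\<exists>y\<in>Q. \<exists>e. (y, e) \<in> ?S \<and> e \<noteq> 0 \<and> \<bar>e\<bar> < \<eta>"
      using Q(2) zz by (intro bexI[of _ y] exI[of _ "z2 - z1"]) auto
  qed
  have "(x, s) \<in> closure ?S"
  proof (rule closure_approachable[THEN iffD2], intro allI impI)
    fix r :: real assume r: "r > 0"
    define Q where "Q = V \<inter> ball x (r/2)"
    have Q: "open Q" "x \<in> Q \<inter> X" unfolding Q_def using V x r by auto
    have msQ: "Q \<inter> vertical_acc ?S \<inter> {0..1} \<in> sets M"
      using Q closed_vertical_acc by (intro sets_M) (auto intro: borel_open borel_closed)
    have "0 < emeasure M (Q \<inter> X)" using pos[OF Q(1)] Q(2) by blast
    also have "\<dots> \<le> emeasure M ((Q \<inter> vertical_acc ?S \<inter> {0..1}) \<union> N)"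
      using acc X N msQ unfolding Q_def by (intro emeasure_mono) auto
    also have "\<dots> = emeasure M (Q \<inter> vertical_acc ?S \<inter> {0..1})"
      using N msQ by (intro emeasure_Un_null_set) auto
    finally have "\<exists>y\<in>Q. \<exists>t\<in>ball s (r/2). (y, t) \<in> ?S"
      using r by (intro skew_invariant_dense_values[OF a b ind M inv S Q(1)]) auto
    then obtain y t where yt: "y \<in> Q" "t \<in> ball s (r/2)" "(y, t) \<in> ?S" by blast
    have "dist (y, t) (x, s) \<le> dist y x + dist t s"
      using sqrt_sum_squares_le_sum_abs[of "dist y x" "dist t s"] by (simp add: dist_prod_def)
    also have "\<dots> < r" using yt unfolding Q_def by (simp add: dist_commute)
    finally show "\<exists>p\<in>?S. dist p (x, s) < r" using yt(3) by blast
  qed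
  then show ?thesis using clS by (simp add: closure_closed)
qed

text \<open>If \<open>U\<close> were missed, \<open>fibre_step\<close> with the difference
  \<open>1/q\<close> could be applied repeatedly, lengthening a progression in the fibres of
  \<open>W\<close> by one term each time. After \<open>q\<close> rounds the progression runs through
  a full period and meets \<open>U\<close> modulo 1.\<close>

lemma hits_of_grid:
  fixes q :: nat
  assumes q: "q > 0" "int q dvd int a - 1" "int q dvd int b - 1"
    and V: "open V" "V \<subseteq> {0<..<1}" "V \<inter> X \<noteq> {}" and U: "open U"
    and grid: "\<And>z. \<exists>l<q. \<exists>n::int. z + real l / q + n \<in> U"
  shows "\<exists>x\<in>V \<inter> X. x \<in> hits b U"
proof (rule ccontr)
  assume miss: "\<not> ?thesis"
  have Une: "U \<noteq> {}" using grid by blast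
  define Y where "Y i = {(x, z). \<forall>l\<le>i. (x, z + real l / q) \<in> W}" for i :: nat
  have Ysk: "skew_invariant a b (Y i)" for i
    unfolding Y_def by (rule skew_invariant_progression[OF W(1) q])
  have "Y i = (\<Inter>l\<in>{..i}. (\<lambda>p. (fst p, snd p + real l / q)) -` W)" for i
    unfolding Y_def by auto
  then have Ycl: "closed (Y i)" for i
    using W(2) by (auto intro!: closed_INT closed_vimage continuous_intros)
  have YW: "Y i \<subseteq> W" for i unfolding Y_def by force
  have "\<forall>x\<in>V \<inter> X. \<exists>z. (x, z) \<in> Y i" for i
  proof (induction i)
    case 0
    have "(x, x) \<in> W" if "x \<in> X" for x
      using orbit_graphI[of x b 0 x 0 0 X] that closure_subset by auto
    then show ?case unfolding Y_def by auto
  next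
    case (Suc i)
    show ?case
    proof
      fix x assume x: "x \<in> V \<inter> X"
      \<comment> \<open>Two progressions of the same length, offset by one step \<open>1/q\<close>,
        overlap to form one with an extra term.\<close>
      obtain z where z: "(x, z) \<in> Y i" "(x, z + 1 / q) \<in> Y i"
        using fibre_step[OF V(1,2) U Une miss Ysk Ycl YW _ x] Suc by blast
      have "(x, z + real l / q) \<in> W" if "l \<le> Suc i" for l
      proof (cases l)
        case 0 then show ?thesis using z(1) unfolding Y_def by auto
      next
        case (Suc l')
        then have "(x, z + 1 / q + real l' / q) \<in> W" using z(2) that unfolding Y_def by auto
        then show ?thesis using Suc by (simp add: add_divide_distrib add.assoc)
      qed
      then show "\<exists>z. (x, z) \<in> Y (Suc i)" unfolding Y_def by blast
    qed
  qed
  then obtain x z where x: "x \<in> V" "(x, z) \<in> Y q" using V(3) by blast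
  obtain l and n :: int where l: "l < q" "z + real l / q + n \<in> U" using grid by blast
  have "(x, z + real l / q) \<in> W" using x(2) l(1) unfolding Y_def by auto
  then have "(x, z + real l / q + of_int n) \<in> W" using skew_invariantD(3)[OF W(1), of x _ 0 n] by simp
  then show False using closure_orbit_graph_hits[OF X V(1,2) U _ x(1) l(2)] miss by blast
qed

end

section \<open>Passing to powers of \<open>a\<close> and \<open>b\<close>\<close>

text \<open>The modulus \<open>a * b * Suc K + 1\<close> exceeds \<open>K\<close> and is coprime to
  both bases, so Euler's theorem applies with \<open>m\<close> the totient of
  \<open>q\<close>.\<close>

lemma ex_modulus_power_one:
  fixes a b K :: nat
  assumes "a \<ge> 2" "b \<ge> 2"
  shows "\<exists>q m. q > K \<and> m > 0 \<and> int q dvd int (a ^ m) - 1 \<and> int q dvd int (b ^ m) - 1"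
proof -
  define P where "P = a * b * Suc K"
  define q where "q = P + 1"
  have "1 * Suc K \<le> P" unfolding P_def using assms by (intro mult_right_mono) auto
  then have "q > K" unfolding q_def by simp
  have "coprime P q" unfolding q_def by (rule coprime_add_one_right)
  then have co: "coprime (a * b * Suc K) q" unfolding P_def .
  have "coprime a q" "coprime b q"
    using co by (metis coprime_mult_left_iff)+
  have "int q dvd int (c ^ totient q) - 1" if "coprime c q" for c
  proof -
    have "[int (c ^ totient q) = int 1] (mod int q)"
      using euler_theorem[OF that] by (simp only: cong_int_iff)
    then show ?thesis by (simp only: cong_iff_dvd_diff of_nat_1)
  qed
  with \<open>coprime a q\<close> \<open>coprime b q\<close>
  have "int q dvd int (a ^ totient q) - 1" "int q dvd int (b ^ totient q) - 1" by blast+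
  moreover have "totient q > 0" using \<open>q > K\<close> by simp
  ultimately show ?thesis using \<open>q > K\<close> by blast
qed

lemma times_map_range: "times_map a x \<in> {0..1}"
  unfolding times_map_def by (simp add: less_imp_le[OF frac_lt_1])

text \<open>The exponent must be positive: the zeroth iterate is the identity, whereas
  \<open>times_map 1\<close> sends 1 to 0.\<close>

lemma times_map_power:
  assumes "m > 0"
  shows "times_map (a ^ m) = times_map a ^^ m"
proof
  fix x
  obtain k where k: "m = Suc k" using assms gr0_implies_Suc by blast
  have "real a ^ m * x - (times_map a ^^ m) x \<in> \<int>"
    using times_map_funpow[of m a x] by (metis Ints_minus minus_diff_eq)
  moreover have "0 \<le> (times_map a ^^ m) x" "(times_map a ^^ m) x < 1"
    by (simp_all add: k times_map_def frac_lt_1)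
  ultimately have "frac (real a ^ m * x) = (times_map a ^^ m) x" by (simp add: frac_unique_iff)
  then show "times_map (a ^ m) x = (times_map a ^^ m) x" by (simp add: times_map_def)
qed

lemma invariant_measure_times_map_power:
  assumes M: "borel_prob_unit_interval M" and inv: "invariant_measure (times_map a) M" and "m > 0"
  shows "invariant_measure (times_map (a ^ m)) M"
proof -
  have "space M = {0..1}" using borel_prob_unit_intervalD(2)[OF M] .
  then show ?thesis
    using invariant_measure_funpow[OF inv, of _ m] times_map_range[of "a ^ m"]
    unfolding invariant_measure_def times_map_power[OF \<open>m > 0\<close>] by (auto intro!: measurableI)
qed

lemma mult_indep_power:
  assumes "mult_indep a b" "m > 0"
  shows "mult_indep (a ^ m) (b ^ m)"
  unfolding mult_indep_def
proof (intro allI impI)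
  fix i j :: nat assume "0 < i" "0 < j"
  then have "a ^ (m * i) \<noteq> b ^ (m * j)" using assms unfolding mult_indep_def by simp
  then show "(a ^ m) ^ i \<noteq> (b ^ m) ^ j" by (simp only: power_mult not_False_eq_True)
qed

lemma hits_power_base: "hits (b ^ m) U \<subseteq> hits b U"
proof
  fix t assume "t \<in> hits (b ^ m) U"
  then obtain j n where "real (b ^ m) ^ j * t + of_int n \<in> U" unfolding hits_def by blast
  then have "real b ^ (m * j) * t + of_int n \<in> U" by (simp add: power_mult)
  then show "t \<in> hits b U" unfolding hits_def by blast
qed

lemma grid_meets_open:
  fixes U :: "real set"
  assumes U: "open U" "U \<noteq> {}"
  shows "\<exists>K. \<forall>q>K. \<forall>z. \<exists>l<q. \<exists>n::int. z + real l / real q + n \<in> U"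
proof -
  obtain u where "u \<in> U" using U by blast
  then obtain \<eta> where \<eta>: "\<eta> > 0" "ball u \<eta> \<subseteq> U" using U openE by blast
  obtain K :: nat where K: "1 / \<eta> < K" using reals_Archimedean2 by blast
  have "\<exists>l<q. \<exists>n::int. z + real l / real q + n \<in> U" if q: "q > K" for q z
  proof -
    have q0: "real q > 0" using q by simp
    have "1 / \<eta> < q" using K q by linarith
    then have q\<eta>: "1 / q < \<eta>" using \<eta>(1) q0 by (simp add: field_simps)
    define l where "l = nat \<lfloor>frac (u - z) * q\<rfloor>"
    have l: "real l = of_int \<lfloor>frac (u - z) * q\<rfloor>" unfolding l_def by simp
    have "frac (u - z) * q < q" using q0 frac_lt_1[of "u - z"] by simp
    then have "real l < real q" using l by linarith
    then have "l < q" by simp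
    have "\<bar>frac (u - z) * q - l\<bar> < 1" using l by linarith
    moreover have "frac (u - z) * q - l = (frac (u - z) - l / q) * q" using q0 by (simp add: field_simps)
    ultimately have "\<bar>frac (u - z) - l / q\<bar> * q < 1" using q0 by (simp add: abs_mult)
    then have "\<bar>frac (u - z) - l / q\<bar> < \<eta>" using q\<eta> q0 by (simp add: pos_less_divide_eq[symmetric])
    then have "z + real l / real q + of_int \<lfloor>u - z\<rfloor> \<in> ball u \<eta>"
      by (simp add: frac_def dist_real_def algebra_simps)
    then show ?thesis using \<open>l < q\<close> \<eta>(2) by blast
  qed
  then show ?thesis by blast
qed

section \<open>Consequences of non-atomicity and full support\<close>

lemma non_atomic_null_singleton:
  assumes "non_atomic M"
  shows "emeasure M {x} = 0"
proof (rule ccontr)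
  assume nz: "emeasure M {x} \<noteq> 0"
  then have "{x} \<in> sets M" using emeasure_notin_sets by blast
  moreover have "emeasure M B = 0 \<or> emeasure M ({x} - B) = 0" if "B \<subseteq> {x}" for B
  proof -
    have "B = {} \<or> B = {x}" using that by blast
    then show ?thesis by auto
  qed
  ultimately have "measure_atom M {x}" using nz by (auto simp: measure_atom_def zero_less_iff_neq_zero)
  then show False using assms unfolding non_atomic_def by blast
qed

text \<open>By the Lindelof property countably many null open sets cover the part of the unit
  interval outside the support. The positive mass of a neighbourhood of a support point is therefore
  carried by \<open>X\<close>.\<close>

lemma measure_support_pos:
  assumes M: "borel_prob_unit_interval M" and X: "measure_support M = X" "closed X"
    and Q: "open Q" "Q \<inter> X \<noteq> {}"
  shows "emeasure M (Q \<inter> X) > 0"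
proof -
  have space: "space M = {0..1}" and msb: "B \<in> sets borel \<Longrightarrow> B \<inter> {0..1} \<in> sets M" for B
    using borel_prob_unit_intervalD[OF M] by auto
  define F where "F = {U. open U \<and> emeasure M (U \<inter> {0..1}) = 0}"
  obtain F' where F': "F' \<subseteq> F" "countable F'" "\<Union>F' = \<Union>F"
    by (rule Lindelof[of F]) (auto simp: F_def)
  have "(\<Union>U\<in>F'. U \<inter> {0..1}) \<in> null_sets M"
    using F' msb unfolding F_def by (intro null_sets_UN') (auto simp: null_sets_def)
  moreover have "{0..1} - X \<subseteq> (\<Union>U\<in>F'. U \<inter> {0..1})"
  proof
    fix x assume x: "x \<in> {0..1} - X"
    then obtain U where "open U" "x \<in> U" "emeasure M (U \<inter> {0..1}) = 0"
      using X(1) unfolding measure_support_def space by (auto simp: zero_less_iff_neq_zero)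
    then have "x \<in> \<Union>F" unfolding F_def by blast
    then show "x \<in> (\<Union>U\<in>F'. U \<inter> {0..1})" using x F'(3) by auto
  qed
  moreover have X01: "X \<subseteq> {0..1}" using X unfolding measure_support_def space by auto
  have msX: "X \<in> sets M" using msb[of X] X X01 by (simp add: Int_absorb2 borel_closed)
  have "{0..1} - X \<in> sets M" using msX space sets.compl_sets by metis
  ultimately have null: "{0..1} - X \<in> null_sets M" using null_sets_subset by blast
  have msQ: "Q \<inter> X \<in> sets M"
  proof -
    have "Q \<inter> X = (Q \<inter> {0..1}) \<inter> X" using X01 by blast
    then show ?thesis using msb[of Q] msX Q by auto
  qed
  obtain x where x: "x \<in> Q" "x \<in> X" using Q by blast
  then have "0 < emeasure M (Q \<inter> {0..1})" using X(1) Q(1) unfolding measure_support_def space by auto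
  also have "\<dots> \<le> emeasure M ((Q \<inter> X) \<union> ({0..1} - X))"
    using msQ null by (intro emeasure_mono) auto
  also have "\<dots> = emeasure M (Q \<inter> X)" using msQ null by (rule emeasure_Un_null_set)
  finally show ?thesis .
qed

section \<open>Density of good points and the Baire category argument\<close>

text \<open>First \<open>q\<close> is taken so large that grids of spacing \<open>1/q\<close> meet
  \<open>U\<close> modulo 1, then \<open>m\<close> so that both powers are 1 modulo
  \<open>q\<close>. The grid argument runs for \<open>a^m\<close> and \<open>b^m\<close>, and hits
  for \<open>b^m\<close> are hits for \<open>b\<close>.\<close>

lemma (in nonatomic_support) dense_hits:
  assumes V: "open V" "V \<inter> X \<noteq> {}" and U: "open U" "U \<noteq> {}"
  shows "V \<inter> X \<inter> hits b U \<noteq> {}"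
proof -
  obtain K where K: "\<And>q z. q > K \<Longrightarrow> \<exists>l<q. \<exists>n::int. z + real l / real q + n \<in> U"
    using grid_meets_open[OF U] by blast
  obtain q m where q: "q > K" "m > 0" "int q dvd int (a ^ m) - 1" "int q dvd int (b ^ m) - 1"
    using ex_modulus_power_one[OF a b] by blast
  have funpow: "(times_map a ^^ k) ` X \<subseteq> X" for k
    by (induction k) (use TX in auto)
  have ge2: "c ^ m \<ge> 2" if "c \<ge> 2" for c :: nat
    using that self_le_power[of c m] q(2) by linarith
  interpret pow: nonatomic_support "a ^ m" "b ^ m" M X
  proof
    show "times_map (a ^ m) ` X \<subseteq> X" using funpow[of m] times_map_power[OF q(2)] by simp
  qed (use ge2 a b X M pos null_singleton mult_indep_power[OF ind q(2)]
    invariant_measure_times_map_power[OF M inv q(2)] in auto)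
  \<comment> \<open>The endpoints are removed as the grid argument requires. Points of
    \<open>X\<close> remain, since \<open>V \<inter> X\<close> has positive measure while 0 and 1
    carry none.\<close>
  define V' where "V' = V \<inter> {0<..<1}"
  have "V' \<inter> X \<noteq> {}"
  proof
    assume e: "V' \<inter> X = {}"
    have "V \<inter> X \<subseteq> {0} \<union> {1}"
    proof
      fix x assume x: "x \<in> V \<inter> X"
      then have "x \<notin> {0<..<1}" "x \<in> {0..1}" using e X unfolding V'_def by auto
      then show "x \<in> {0} \<union> {1}" by auto
    qed
    moreover have sg: "{x} \<in> null_sets M" if "x \<in> {0..1}" for x
    proof -
      have "{x} \<inter> {0..1} \<in> sets M" using borel_prob_unit_intervalD(3)[OF M] by simp
      then show ?thesis using that null_singleton by (auto simp: null_sets_def)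
    qed
    ultimately have "emeasure M (V \<inter> X) \<le> emeasure M ({0} \<union> {1})"
      using null_setsD2[OF null_sets.Un[OF sg[of 0] sg[of 1]]] by (intro emeasure_mono) auto
    also have "\<dots> = 0" using null_setsD1[OF null_sets.Un[OF sg[of 0] sg[of 1]]] by simp
    finally show False using pos[OF V] by simp
  qed
  moreover have "open V'" "V' \<subseteq> {0<..<1}" unfolding V'_def using V by auto
  ultimately obtain x where "x \<in> V'" "x \<in> X" "x \<in> hits (b ^ m) U"
    using pow.hits_of_grid[of q V' U] q K U by auto
  then show ?thesis using hits_power_base unfolding V'_def by blast
qed

lemma forward_orbit_dense:
  assumes x: "x \<in> {0..1}" and B: "\<And>Q. open Q \<Longrightarrow> Q \<noteq> {} \<Longrightarrow> x \<in> hits b Q"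
  shows "(top_of_set {0..1}) closure_of (forward_orbit (times_map b) x) = {0..1}"
proof -
  have orb: "(times_map b ^^ n) x \<in> {0..1}" for n
    by (cases n) (use x times_map_range in auto)
  have "{0<..<1} \<subseteq> closure (forward_orbit (times_map b) x)"
  proof
    fix y :: real assume y: "y \<in> {0<..<1}"
    have "\<exists>w\<in>forward_orbit (times_map b) x. dist w y < r" if r: "r > 0" for r
    proof -
      have "y \<in> ball y r \<inter> {0<..<1}" using y r by simp
      then have "ball y r \<inter> {0<..<1} \<noteq> {}" by blast
      moreover have "open (ball y r \<inter> {0<..<1})" by auto
      \<comment> \<open>Intersecting the target with the open unit interval forces the integer
        between the lifted orbit point and the actual iterate, which lies in \<open>{0..1}\<close>,
        to be 0.\<close>
      ultimately have "x \<in> hits b (ball y r \<inter> {0<..<1})" by (intro B)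
      then obtain j n where w: "real b ^ j * x + of_int n \<in> ball y r \<inter> {0<..<1}" unfolding hits_def by blast
      let ?t = "(times_map b ^^ j) x"
      obtain k where k: "?t - real b ^ j * x = of_int k" using times_map_funpow Ints_cases by metis
      have "0 \<le> ?t" "?t \<le> 1" using orb by auto
      moreover have "?t = (real b ^ j * x + of_int n) + of_int (k - n)" using k by simp
      moreover have "0 < real b ^ j * x + of_int n" "real b ^ j * x + of_int n < 1" using w by auto
      ultimately have "k - n = 0" by linarith
      then have "?t = real b ^ j * x + of_int n" using k by simp
      then have "dist ?t y < r" using w by (simp add: dist_commute)
      then show ?thesis unfolding forward_orbit_def by blast
    qed
    then show "y \<in> closure (forward_orbit (times_map b) x)" by (simp add: closure_approachable)
  qed
  then have "closure {0<..<1} \<subseteq> closure (forward_orbit (times_map b) x)"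
    by (rule closure_minimal) simp
  then have "{0..1} \<subseteq> closure (forward_orbit (times_map b) x)" by simp
  moreover have "{0..1} \<inter> forward_orbit (times_map b) x = forward_orbit (times_map b) x"
    using orb unfolding forward_orbit_def by auto
  ultimately show ?thesis by (auto simp: closure_of_subtopology)
qed

theorem corollary1p3:
  fixes a b :: nat and X :: "real set"
  assumes "a \<ge> 2" and "b \<ge> 2"
    and "mult_indep a b"
    and "X \<subseteq> {0..1}" and "closed X"
    and "times_map a ` X \<subseteq> X"
    and "\<exists>M. borel_prob_unit_interval M \<and> non_atomic M \<and>
             invariant_measure (times_map a) M \<and> measure_support M = X"
  shows "\<exists>G. gdelta_in (top_of_set X) G \<and>
             (top_of_set X) closure_of G = X \<and>
             (\<forall>x\<in>G. (top_of_set {0..1}) closure_of (forward_orbit (times_map b) x) = {0..1})"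
proof -
  obtain M where M: "borel_prob_unit_interval M" "non_atomic M"
    "invariant_measure (times_map a) M" "measure_support M = X"
    using assms(7) by blast
  interpret nonatomic_support a b M X
    using assms M measure_support_pos non_atomic_null_singleton by unfold_locales auto
  obtain \<B> :: "real set set" where \<B>: "countable \<B>" "topological_basis \<B>"
    using ex_countable_basis by blast
  \<comment> \<open>Inserting \<open>UNIV\<close> makes the family visibly nonempty, so that its
    intersection lies in \<open>X\<close>.\<close>
  define \<G> where "\<G> = (\<lambda>C. X \<inter> hits b C) ` insert UNIV (\<B> - {{}})"
  have cG: "countable \<G>" unfolding \<G>_def using \<B>(1) by auto
  have open_dense: "openin (top_of_set X) T \<and> X \<subseteq> closure T" if T: "T \<in> \<G>" for T
  proof -
    obtain C where C: "T = X \<inter> hits b C" "open C" "C \<noteq> {}" using T topological_basis_open[OF \<B>(2)] unfolding \<G>_def by auto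
    have "X \<subseteq> closure T"
    proof
      fix x assume x: "x \<in> X"
      have "\<exists>y\<in>T. dist y x < r" if "r > 0" for r
      proof -
        have "x \<in> ball x r \<inter> X" using x that by simp
        then have "ball x r \<inter> X \<noteq> {}" by blast
        then obtain y where "y \<in> ball x r" "y \<in> T"
          using dense_hits[OF open_ball _ C(2,3)] C(1) by blast
        then show ?thesis by (auto simp: dist_commute)
      qed
      then show "x \<in> closure T" by (simp add: closure_approachable)
    qed
    then show ?thesis using C hits_open by (auto intro: openin_open_Int)
  qed
  define G where "G = \<Inter>\<G>"
  have GX: "G \<subseteq> X" unfolding G_def \<G>_def by auto
  have "gdelta_in (top_of_set X) G"
    unfolding G_def using cG open_dense open_imp_gdelta_in
    by (intro gdelta_in_Inter) (auto simp: \<G>_def)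
  moreover have "(top_of_set X) closure_of G = X"
    \<comment> \<open>Closedness of \<open>X\<close> in the reals allows the Baire theorem to be
      applied within \<open>X\<close>.\<close>
    using Baire[OF assms(5) cG open_dense] GX
    by (auto simp: closure_of_subtopology G_def Int_absorb1)
  moreover have "(top_of_set {0..1}) closure_of (forward_orbit (times_map b) x) = {0..1}" if x: "x \<in> G" for x
  proof (rule forward_orbit_dense)
    show "x \<in> {0..1}" using x GX assms(4) by blast
    fix Q :: "real set" assume Q: "open Q" "Q \<noteq> {}"
    then obtain y where y: "y \<in> Q" by blast
    obtain C where C: "C \<in> \<B>" "y \<in> C" "C \<subseteq> Q" by (rule topological_basisE[OF \<B>(2) Q(1) y])
    then have "X \<inter> hits b C \<in> \<G>" unfolding \<G>_def by blast
    then have "x \<in> hits b C" using x unfolding G_def by blast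
    then show "x \<in> hits b Q" using C(3) unfolding hits_def by blast
  qed
  ultimately show ?thesis by blast
qed

end
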